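(* Let $\Omega\subset\mathbb{R}^3$ be a bounded domain with smooth boundary, $k>-1$ and $\beta\in(k+2,k+\frac83)$. Then for every $m^*>0$ there exist $C_1=C_1(k,\beta)>0$ and $C_2=C_2(m^*,k,\beta)>0$ such that whenever $\varphi\in C^1(\overline\Omega)$ and $\psi\in C^1(\overline\Omega)$ are positive in $\overline\Omega$ and $\int_\Omega\varphi\le m^*$, one has $$\int_\Omega\varphi^\beta\psi\le2\int_\Omega\varphi^k\psi|\nabla\varphi|^2+C_1\int_\Omega\frac{|\nabla\psi|^{\frac{2\beta}{\beta-k-2}}}{\psi^{\frac{2\beta}{\beta-k-2}-1}}+C_2\int_\Omega\varphi\psi.$$
   Context: Constants may also depend on $\Omega$; $C_1$ does not depend on $m^*$. *)

theory Defs
  imports "HOL-Analysis.Analysis"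
begin

text \<open>On an open set \<open>S\<close>, continuity of all partial derivatives of order at most \<open>n\<close>.\<close>

primrec Ck_on :: "nat \<Rightarrow> 'a::euclidean_space set \<Rightarrow> ('a \<Rightarrow> real) \<Rightarrow> bool" where
  "Ck_on 0 S f \<longleftrightarrow> continuous_on S f"
| "Ck_on (Suc n) S f \<longleftrightarrow>
     (\<forall>x\<in>S. f differentiable (at x)) \<and>
     (\<forall>v. Ck_on n S (\<lambda>x. frechet_derivative f (at x) v))"

definition smooth_on :: "'a::euclidean_space set \<Rightarrow> ('a \<Rightarrow> real) \<Rightarrow> bool" where
  "smooth_on S f \<longleftrightarrow> (\<forall>n. Ck_on n S f)"

text \<open>
  Near each boundary point, and in suitable Cartesian coordinates, the set is exactly the part
  lying strictly above the graph of a smooth function. The linear map \<open>T\<close> only rotates or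
  reflects the axes; no translation is needed, since the graph function is arbitrary.
\<close>

definition smooth_boundary :: "(real^3) set \<Rightarrow> bool" where
  "smooth_boundary \<Omega> \<longleftrightarrow>
     (\<forall>p\<in>frontier \<Omega>. \<exists>r>0. \<exists>(T :: real^3 \<Rightarrow> real^3) (\<gamma> :: real^2 \<Rightarrow> real).
        orthogonal_transformation T \<and> smooth_on UNIV \<gamma> \<and>
        \<Omega> \<inter> ball p r = {x \<in> ball p r. \<gamma> (vector [T x $ 1, T x $ 2]) < T x $ 3})"

text \<open>Only meaningful where \<open>f\<close> is differentiable.\<close>

definition gradient :: "('a::real_inner \<Rightarrow> real) \<Rightarrow> 'a \<Rightarrow> 'a" where
  "gradient f x = (THE D. GDERIV f x :> D)"

text \<open>
  \<open>C\<^sup>1\<close> up to the boundary of an open set \<open>\<Omega>\<close>: the function is continuous on the closure,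
  differentiable in \<open>\<Omega>\<close>, and its gradient in \<open>\<Omega>\<close> extends continuously to the closure.
  Values off the closure are irrelevant.
\<close>

definition C1_closure :: "'a::real_inner set \<Rightarrow> ('a \<Rightarrow> real) \<Rightarrow> bool" where
  "C1_closure \<Omega> f \<longleftrightarrow>
     continuous_on (closure \<Omega>) f \<and>
     (\<exists>G. continuous_on (closure \<Omega>) G \<and> (\<forall>x\<in>\<Omega>. GDERIV f x :> G x))"

end

theory Submission
  imports Defs
begin

text \<open>
  Put \<open>\<theta> = \<beta> - k - 2 < 2/3\<close> and \<open>w = \<phi>^((k+2)/2) \<psi>^(1/2)\<close>, so that \<open>\<phi>^\<beta> \<psi> = \<phi>^\<theta> w^2\<close>. Since \<open>\<phi>^\<theta>\<close> is
  bounded in \<open>L^(1/\<theta>)\<close> with \<open>1/\<theta> > 3/2\<close>, it is an infinitesimally form-bounded potential: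
  \<open>\<integral> \<phi>^\<theta> w^2 \<le> \<epsilon> \<integral> |\<nabla>w|^2 + C \<integral> w^2\<close>. Pointwise Young inequalities applied to \<open>|\<nabla>w|^2\<close> and \<open>w^2\<close>
  produce \<open>\<integral> \<phi>^\<beta> \<psi>\<close> with a small factor, which is absorbed.

  The form bound needs no Sobolev embedding. The smooth boundary gives a uniform interior cone
  condition, so \<open>w x\<close> can be compared with \<open>w (x + \<eta>^N v)\<close> along the curve \<open>s \<mapsto> x + s^N v\<close> for all
  \<open>v\<close> in a ball of fixed radius. Squaring, averaging over \<open>v\<close> and integrating against \<open>\<phi>^\<theta>\<close>
  leaves the integrals \<open>\<integral>\<integral> \<phi>(x)^\<theta> |\<nabla>w (x + s^N v)|^2 dv dx = O(s^(-3N\<theta>)) \<integral> |\<nabla>w|^2\<close>; the factor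
  \<open>s^(2N-2)\<close> coming from the parametrisation cancels this singularity once \<open>N (2 - 3\<theta>) \<ge> 2\<close>.
\<close>

subsection \<open>The interior cone condition\<close>

text \<open>A truncated cone with vertex \<open>x\<close>, its opening described by a ball of
  directions rather than an angle. One number \<open>d\<close> bounds both opening and height, so
  shrinking it is monotone. The axis has norm at most 1 instead of exactly 1, which admits the axis
  0 at interior points.\<close>

definition cone_at :: "real \<Rightarrow> 'a::real_normed_vector set \<Rightarrow> 'a \<Rightarrow> bool" where
  "cone_at d S x \<longleftrightarrow> (\<exists>\<nu>. norm \<nu> \<le> 1 \<and> (\<forall>v\<in>ball \<nu> d. \<forall>t\<in>{0..d}. x + t *\<^sub>R v \<in> S))"

lemma cone_at_mono:
  assumes "cone_at d S x" and "d' \<le> d"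
  shows "cone_at d' S x"
  using assms unfolding cone_at_def by (fastforce simp: subset_eq)

section \<open>Lipschitz bounds for the boundary graph\<close>

text \<open>Continuous directional derivatives are bounded on the compact ball. Summing the bounds
  over the basis controls the operator norm of the derivative, and the mean value inequality applies
  because the ball is convex.\<close>

lemma smooth_on_UNIV_imp_lipschitz_on_cball:
  fixes \<gamma> :: "'a::euclidean_space \<Rightarrow> real"
  assumes "smooth_on UNIV \<gamma>"
  shows "\<exists>L\<ge>0. \<forall>y\<in>cball c R. \<forall>z\<in>cball c R. \<bar>\<gamma> y - \<gamma> z\<bar> \<le> L * norm (y - z)"
proof -
  let ?D = "\<lambda>x. frechet_derivative \<gamma> (at x)"
  have C1: "Ck_on (Suc 0) UNIV \<gamma>"
    using assms unfolding smooth_on_def by blast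
  then have diff: "(\<gamma> has_derivative ?D x) (at x)" for x
    using frechet_derivative_works by fastforce
  have cont: "continuous_on UNIV (\<lambda>x. ?D x v)" for v
    using C1 by simp
  have "\<exists>M. \<forall>x\<in>cball c R. \<bar>?D x b\<bar> \<le> M" for b
  proof -
    have "compact ((\<lambda>x. ?D x b) ` cball c R)"
      using continuous_on_subset[OF cont] by (intro compact_continuous_image) auto
    then show ?thesis
      using compact_imp_bounded[of "(\<lambda>x. ?D x b) ` cball c R"]
      by (auto simp: bounded_iff)
  qed
  then obtain M where M: "\<And>b x. x \<in> cball c R \<Longrightarrow> \<bar>?D x b\<bar> \<le> M b"
    by metis
  \<comment> \<open>The absolute values keep \<open>L\<close> nonnegative even when the ball is
    empty and \<open>M\<close> is arbitrary.\<close>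
  define L where "L = (\<Sum>b\<in>Basis. \<bar>M b\<bar>)"
  have "norm (?D x v) \<le> L * norm v" if x: "x \<in> cball c R" for x v
  proof -
    interpret bounded_linear "?D x"
      using diff has_derivative_bounded_linear by blast
    have "?D x v = ?D x (\<Sum>b\<in>Basis. (v \<bullet> b) *\<^sub>R b)"
      by (simp add: euclidean_representation)
    also have "\<dots> = (\<Sum>b\<in>Basis. (v \<bullet> b) * ?D x b)"
      by (simp add: sum scaleR)
    also have "norm \<dots> \<le> (\<Sum>b\<in>Basis. norm v * \<bar>M b\<bar>)"
    proof (rule order_trans[OF norm_sum], rule sum_mono)
      fix b :: 'a assume b: "b \<in> Basis"
      have "\<bar>v \<bullet> b\<bar> \<le> norm v"
        using Basis_le_norm b by blast
      moreover have "\<bar>?D x b\<bar> \<le> \<bar>M b\<bar>"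
        using M[OF x, of b] by linarith
      ultimately show "norm ((v \<bullet> b) * ?D x b) \<le> norm v * \<bar>M b\<bar>"
        by (simp add: abs_mult mult_mono)
    qed
    finally show ?thesis
      by (simp add: L_def sum_distrib_left mult.commute)
  qed
  then have "onorm (?D x) \<le> L" if "x \<in> cball c R" for x
    using that by (intro onorm_le) auto
  then have "norm (\<gamma> y - \<gamma> z) \<le> L * norm (y - z)"
    if "y \<in> cball c R" "z \<in> cball c R" for y z
    using that has_derivative_at_withinI[OF diff]
    by (intro differentiable_bound[of "cball c R" \<gamma> ?D]) auto
  moreover have "L \<ge> 0"
    by (simp add: L_def sum_nonneg)
  ultimately show ?thesis
    by auto
qed

lemma norm_vector_2_le:
  fixes y :: "real^3"
  shows "norm (vector [y $ 1, y $ 2] :: real^2) \<le> norm y"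
  by (simp add: norm_vec_def L2_set_def sum_2 sum_3)

section \<open>Local cones and their uniform size\<close>

text \<open>Above an \<open>L\<close>-Lipschitz graph, a step \<open>t *\<^sub>R v\<close> with
  \<open>T v\<close> within \<open>d\<close> of the vertical unit vector gains height at least
  \<open>t * (1 - d)\<close>, while the graph below rises by at most \<open>L * t * d\<close>. For
  small \<open>d\<close> the point therefore stays strictly above the graph.\<close>

lemma smooth_boundary_imp_local_cone:
  assumes "smooth_boundary \<Omega>" and "p \<in> frontier \<Omega>"
  shows "\<exists>d>0. \<forall>x\<in>\<Omega> \<inter> ball p d. cone_at d \<Omega> x"
proof -
  define P :: "real^3 \<Rightarrow> real^2" where "P = (\<lambda>y. vector [y $ 1, y $ 2])"
  obtain r T and \<gamma> :: "real^2 \<Rightarrow> real" where "r > 0" and T: "orthogonal_transformation T"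
    and "smooth_on UNIV \<gamma>"
    and \<Omega>: "\<Omega> \<inter> ball p r = {x \<in> ball p r. \<gamma> (P (T x)) < T x $ 3}"
    using assms unfolding smooth_boundary_def P_def by meson
  have mem_iff: "y \<in> \<Omega> \<longleftrightarrow> \<gamma> (P (T y)) < T y $ 3" if "dist p y < r" for y
    using that arg_cong[OF \<Omega>, of "\<lambda>X. y \<in> X"] by simp
  obtain L where "L \<ge> 0"
    and L: "\<And>y z. y \<in> cball (P (T p)) r \<Longrightarrow> z \<in> cball (P (T p)) r
                  \<Longrightarrow> \<bar>\<gamma> y - \<gamma> z\<bar> \<le> L * norm (y - z)"
    using smooth_on_UNIV_imp_lipschitz_on_cball[OF \<open>smooth_on UNIV \<gamma>\<close>] by meson
  have P_diff: "P y - P z = P (y - z)" and P_scale: "P (c *\<^sub>R y) = c *\<^sub>R P y" for y z c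
    by (auto simp: P_def vec_eq_iff forall_2)
  have P_le: "norm (P y) \<le> norm y" for y
    unfolding P_def by (rule norm_vector_2_le)
  have P_axis: "P (axis 3 1) = 0"
    by (auto simp: P_def vec_eq_iff forall_2 axis_def)
  have linT: "linear T"
    using T orthogonal_transformation_linear by blast
  have normT: "norm (T y) = norm y" for y
    using T orthogonal_transformation_norm by blast
  obtain \<nu> where \<nu>: "T \<nu> = axis 3 1"
    using orthogonal_transformation_surj[OF T] by (metis surjD)
  have "norm \<nu> = 1"
    using normT[of \<nu>] by (simp add: \<nu>)
  \<comment> \<open>The bound \<open>1/(L+1)\<close> gives \<open>L * d \<le> 1 - d\<close>. The
    bound 1 gives \<open>norm v \<le> 2\<close>, so the shifted point is within \<open>3 * d\<close>
    of \<open>p\<close>, and \<open>r/4\<close> keeps it inside \<open>ball p r\<close>, where the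
    graph describes \<open>\<Omega>\<close>.\<close>
  define d where "d = min 1 (min (r/4) (1/(L+1)))"
  have "d > 0" "d \<le> 1" "d \<le> r/4" "d \<le> 1/(L+1)"
    using \<open>r > 0\<close> \<open>L \<ge> 0\<close> by (auto simp: d_def)
  have Ld: "L * d \<le> 1 - d"
    using \<open>d \<le> 1/(L+1)\<close> \<open>L \<ge> 0\<close> by (simp add: field_simps)
  have "x + t *\<^sub>R v \<in> \<Omega>"
    if x: "x \<in> \<Omega>" "dist p x < d" and v: "dist \<nu> v < d" and t: "0 \<le> t" "t \<le> d" for x v t
  proof -
    have "norm v \<le> 2"
      using v \<open>norm \<nu> = 1\<close> \<open>d \<le> 1\<close> norm_triangle_ineq[of \<nu> "v - \<nu>"]
      by (simp add: dist_norm norm_minus_commute)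
    then have "norm (t *\<^sub>R v) \<le> d * 2"
      using t by (auto intro!: mult_mono)
    then have "dist x (x + t *\<^sub>R v) \<le> 2 * d"
      by (simp add: dist_norm)
    then have in_ball: "dist p (x + t *\<^sub>R v) < r"
      using x \<open>d \<le> r/4\<close> \<open>d > 0\<close> dist_triangle[of p "x + t *\<^sub>R v" x] by linarith
    have "dist p x < r"
      using x \<open>d \<le> r/4\<close> \<open>d > 0\<close> by linarith
    have cball: "P (T y) \<in> cball (P (T p)) r" if "dist p y < r" for y
      using that P_le[of "T (p - y)"]
      by (simp add: dist_norm P_diff normT linear_diff[OF linT, symmetric])
    have Tv: "norm (T v - axis 3 1) < d"
      using v by (simp add: \<nu>[symmetric] linear_diff[OF linT, symmetric] normT dist_norm norm_minus_commute)
    have Txv: "T (x + t *\<^sub>R v) = T x + t *\<^sub>R T v"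
      by (simp add: linear_add[OF linT] linear_scale[OF linT])
    have "\<bar>\<gamma> (P (T (x + t *\<^sub>R v))) - \<gamma> (P (T x))\<bar> \<le> L * norm (P (T (x + t *\<^sub>R v)) - P (T x))"
      using in_ball \<open>dist p x < r\<close> by (intro L cball)
    \<comment> \<open>\<open>P\<close> annihilates the vertical axis, so only the deviation of
      \<open>T v\<close> from it moves the base point of the graph.\<close>
    also have "P (T (x + t *\<^sub>R v)) - P (T x) = t *\<^sub>R P (T v - axis 3 1)"
      using P_diff[of "T v" "axis 3 1"] by (simp add: P_diff Txv P_scale P_axis)
    also have "L * norm (t *\<^sub>R P (T v - axis 3 1)) \<le> L * (t * d)"
      using \<open>L \<ge> 0\<close> t Tv P_le[of "T v - axis 3 1"] by (auto intro!: mult_left_mono)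
    also have "\<dots> = t * (L * d)"
      by simp
    also have "\<dots> \<le> t * (1 - d)"
      using Ld t by (intro mult_left_mono)
    finally have "\<gamma> (P (T (x + t *\<^sub>R v))) \<le> \<gamma> (P (T x)) + t * (1 - d)"
      by linarith
    moreover have "\<gamma> (P (T x)) < T x $ 3"
      using mem_iff x \<open>dist p x < r\<close> by blast
    moreover have "\<bar>(T v - axis 3 1) $ 3\<bar> < d"
      using component_le_norm_cart[of "T v - axis 3 1" 3] Tv by linarith
    then have "1 - d \<le> T v $ 3"
      by simp
    then have "t * (1 - d) \<le> t * T v $ 3"
      using t by (intro mult_left_mono) auto
    then have "T x $ 3 + t * (1 - d) \<le> T (x + t *\<^sub>R v) $ 3"
      by (simp add: Txv)
    ultimately show ?thesis
      using mem_iff[OF in_ball] by linarith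
  qed
  then have "\<forall>x\<in>\<Omega> \<inter> ball p d. cone_at d \<Omega> x"
    using \<open>norm \<nu> = 1\<close> unfolding cone_at_def by (intro ballI exI[of _ \<nu>]) simp
  then show ?thesis
    using \<open>d > 0\<close> by blast
qed

text \<open>Around an interior point the axis 0 works: all short displacements remain in a ball
  contained in \<open>S\<close>.\<close>

lemma open_imp_local_cone:
  fixes S :: "'a::real_normed_vector set"
  assumes "open S" and "p \<in> S"
  shows "\<exists>d>0. \<forall>x\<in>S \<inter> ball p d. cone_at d S x"
proof -
  obtain e where "e > 0" and e: "ball p e \<subseteq> S"
    using assms open_contains_ball by blast
  define d where "d = min 1 (e/4)"
  have d: "d > 0" "d \<le> 1" "d \<le> e/4"
    using \<open>e > 0\<close> by (auto simp: d_def)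
  have "x + t *\<^sub>R v \<in> S" if "dist p x < d" "norm v < d" "0 \<le> t" "t \<le> d" for x v t
  proof -
    have "norm (t *\<^sub>R v) \<le> 1 * d"
      using that d by (simp only: norm_scaleR) (rule mult_mono, auto)
    then have "dist x (x + t *\<^sub>R v) \<le> d"
      by (simp add: dist_norm)
    then have "dist p (x + t *\<^sub>R v) < e"
      using that d dist_triangle[of p "x + t *\<^sub>R v" x] by linarith
    then show ?thesis
      using e by auto
  qed
  then have "\<forall>x\<in>S \<inter> ball p d. cone_at d S x"
    unfolding cone_at_def by (intro ballI exI[of _ 0]) simp
  then show ?thesis
    using d by blast
qed

text \<open>Each point of the closure has a neighbourhood with a common cone size, from openness or
  from the boundary graph. The closure is compact, so finitely many neighbourhoods suffice and the
  smallest size serves everywhere.\<close>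

lemma uniform_cone:
  assumes "open \<Omega>" and "bounded \<Omega>" and "smooth_boundary \<Omega>"
  shows "\<exists>d>0. d \<le> 1 \<and> (\<forall>x\<in>\<Omega>. cone_at d \<Omega> x)"
proof -
  have "\<exists>d>0. \<forall>x\<in>\<Omega> \<inter> ball p d. cone_at d \<Omega> x" if "p \<in> closure \<Omega>" for p
  proof (cases "p \<in> \<Omega>")
    case False
    then have "p \<in> frontier \<Omega>"
      using that \<open>open \<Omega>\<close> by (simp add: frontier_def interior_open)
    then show ?thesis
      using smooth_boundary_imp_local_cone assms by blast
  qed (use open_imp_local_cone assms in blast)
  then obtain d where d: "\<And>p. p \<in> closure \<Omega> \<Longrightarrow> d p > 0"
    and cone: "\<And>p x. p \<in> closure \<Omega> \<Longrightarrow> x \<in> \<Omega> \<Longrightarrow> dist p x < d p \<Longrightarrow> cone_at (d p) \<Omega> x"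
    by (metis IntI mem_ball)
  have "compact (closure \<Omega>)"
    using \<open>bounded \<Omega>\<close> by simp
  then obtain F where F: "F \<subseteq> closure \<Omega>" "finite F" "closure \<Omega> \<subseteq> (\<Union>p\<in>F. ball p (d p))"
    using d by (elim compactE_image[of _ "closure \<Omega>" "\<lambda>p. ball p (d p)"]) force+
  \<comment> \<open>Inserting 1 makes the minimum meaningful for an empty cover and enforces
    \<open>m \<le> 1\<close>.\<close>
  define m where "m = Min (insert 1 (d ` F))"
  have "m > 0"
    using F d by (auto simp: m_def)
  moreover have "m \<le> 1"
    using F by (simp add: m_def)
  moreover have "cone_at m \<Omega> x" if "x \<in> \<Omega>" for x
  proof -
    have "x \<in> closure \<Omega>"
      using that closure_subset by blast
    then obtain p where "p \<in> F" "dist p x < d p"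
      using F(3) by (auto dest!: subsetD)
    then have "cone_at (d p) \<Omega> x"
      using F that by (intro cone) auto
    moreover have "m \<le> d p"
      using F \<open>p \<in> F\<close> by (simp add: m_def)
    ultimately show ?thesis
      by (rule cone_at_mono)
  qed
  ultimately show ?thesis
    by blast
qed

subsection \<open>Form boundedness of the potential\<close>

text \<open>Cauchy-Schwarz against the constant 1, read off from the nonnegative integral of
  \<open>(f s - c)\<^sup>2\<close> with \<open>c\<close> the mean of \<open>f\<close>.\<close>

lemma integral_square_le:
  fixes f :: "real \<Rightarrow> real"
  assumes "continuous_on {0..\<eta>} f" and "\<eta> \<ge> 0"
  shows "(integral {0..\<eta>} f)\<^sup>2 \<le> \<eta> * integral {0..\<eta>} (\<lambda>s. (f s)\<^sup>2)"
proof (cases "\<eta> = 0")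
  case False
  define I where "I = integral {0..\<eta>} f"
  define c where "c = I / \<eta>"
  have i: "f integrable_on {0..\<eta>}" "(\<lambda>s. (f s)\<^sup>2) integrable_on {0..\<eta>}"
    using assms by (auto intro!: integrable_continuous_real continuous_intros)
  have "0 \<le> integral {0..\<eta>} (\<lambda>s. (f s - c)\<^sup>2)"
    using assms by (intro integral_nonneg integrable_continuous_real continuous_intros) auto
  also have "(\<lambda>s. (f s - c)\<^sup>2) = (\<lambda>s. (f s)\<^sup>2 - (2 * c) * f s + c\<^sup>2)"
    by (auto simp: power2_eq_square algebra_simps)
  also have "integral {0..\<eta>} \<dots> = integral {0..\<eta>} (\<lambda>s. (f s)\<^sup>2) - 2 * c * I + c\<^sup>2 * \<eta>"
  proof -
    have "((\<lambda>s. (f s)\<^sup>2 - (2 * c) * f s + c\<^sup>2) has_integral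
        integral {0..\<eta>} (\<lambda>s. (f s)\<^sup>2) - (2 * c) * I + (\<eta> - 0) *\<^sub>R c\<^sup>2) {0..\<eta>}"
      unfolding I_def using i \<open>\<eta> \<ge> 0\<close> has_integral_const_real[of "c\<^sup>2" 0 \<eta>]
      by (intro has_integral_add has_integral_diff has_integral_mult_right integrable_integral) auto
    then show ?thesis
      by (simp add: integral_unique mult.commute)
  qed
  finally have "0 \<le> \<eta> * (integral {0..\<eta>} (\<lambda>s. (f s)\<^sup>2) - 2 * c * I + c\<^sup>2 * \<eta>)"
    using assms by simp
  also have "\<dots> = \<eta> * integral {0..\<eta>} (\<lambda>s. (f s)\<^sup>2) - I\<^sup>2"
    using False by (simp add: c_def field_simps power2_eq_square)
  finally show ?thesis
    by (simp add: I_def)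
qed auto

text \<open>The fundamental theorem of calculus along \<open>x + s ^ N *\<^sub>R v\<close>, then
  Cauchy-Schwarz in \<open>s\<close>. The speed of the curve leaves the weight
  \<open>(s ^ (N - 1))\<^sup>2\<close>, which later offsets a singularity at \<open>s = 0\<close>.
  The constant 8 is 2 from splitting the square times 4 from \<open>norm v \<le> 2\<close>.\<close>

lemma ray_square_bound:
  fixes w :: "'a::euclidean_space \<Rightarrow> real" and G :: "'a \<Rightarrow> 'a"
  assumes contG: "continuous_on S G" and G: "\<And>y. y \<in> S \<Longrightarrow> GDERIV w y :> G y"
    and ray: "\<And>t. t \<in> {0..\<eta> ^ N} \<Longrightarrow> x + t *\<^sub>R v \<in> S"
    and "norm v \<le> 2" and "\<eta> \<ge> 0" and "N \<ge> 1"
  shows "(w x)\<^sup>2 \<le> 2 * (w (x + \<eta> ^ N *\<^sub>R v))\<^sup>2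
    + 8 * (real N)\<^sup>2 * \<eta> * integral {0..\<eta>} (\<lambda>s. (s ^ (N - 1))\<^sup>2 * (norm (G (x + s ^ N *\<^sub>R v)))\<^sup>2)"
proof -
  define F where "F s = w (x + s ^ N *\<^sub>R v)" for s :: real
  define f where "f s = (real N * s ^ (N - 1)) * (v \<bullet> G (x + s ^ N *\<^sub>R v))" for s :: real
  have in_S: "x + s ^ N *\<^sub>R v \<in> S" if "s \<in> {0..\<eta>}" for s
    using that by (intro ray) (auto intro: power_mono)
  have cG: "continuous_on {0..\<eta>} (\<lambda>s. G (x + s ^ N *\<^sub>R v))"
    using in_S by (intro continuous_on_compose2[OF contG] continuous_intros) auto
  have cf: "continuous_on {0..\<eta>} f"
    unfolding f_def by (intro continuous_intros cG)
  have "(F has_vector_derivative f s) (at s within {0..\<eta>})" if "s \<in> {0..\<eta>}" for s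
  proof -
    have 1: "((\<lambda>s. x + s ^ N *\<^sub>R v) has_derivative (\<lambda>h. (h * (N * s ^ (N - 1))) *\<^sub>R v)) (at s within {0..\<eta>})"
      by (auto intro!: derivative_eq_intros simp: mult_ac)
    have 2: "(w has_derivative (\<lambda>h. h \<bullet> G (x + s ^ N *\<^sub>R v))) (at (x + s ^ N *\<^sub>R v))"
      using G[OF in_S[OF that]] by (simp add: gderiv_def)
    show ?thesis
      using has_derivative_compose[OF 1 2]
      by (simp add: has_vector_derivative_def F_def[abs_def] f_def mult_ac)
  qed
  then have "integral {0..\<eta>} f = F \<eta> - F 0"
    using \<open>\<eta> \<ge> 0\<close> fundamental_theorem_of_calculus integral_unique by blast
  \<comment> \<open>\<open>N \<ge> 1\<close> ensures \<open>0 ^ N = 0\<close>, so that the curve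
    starts at \<open>x\<close>.\<close>
  also have "\<dots> = w (x + \<eta> ^ N *\<^sub>R v) - w x"
    using \<open>N \<ge> 1\<close> by (simp add: F_def zero_power)
  finally have "w x = w (x + \<eta> ^ N *\<^sub>R v) - integral {0..\<eta>} f"
    by simp
  moreover have "(p - q)\<^sup>2 \<le> 2 * p\<^sup>2 + 2 * q\<^sup>2" for p q :: real
    using zero_le_power2[of "p + q"] by (simp add: power2_eq_square algebra_simps)
  ultimately have "(w x)\<^sup>2 \<le> 2 * (w (x + \<eta> ^ N *\<^sub>R v))\<^sup>2 + 2 * (integral {0..\<eta>} f)\<^sup>2"
    by presburger
  also have "(integral {0..\<eta>} f)\<^sup>2 \<le> \<eta> * integral {0..\<eta>} (\<lambda>s. (f s)\<^sup>2)"
    by (rule integral_square_le[OF cf \<open>\<eta> \<ge> 0\<close>])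
  also have "integral {0..\<eta>} (\<lambda>s. (f s)\<^sup>2)
    \<le> integral {0..\<eta>} (\<lambda>s. 4 * (real N)\<^sup>2 * ((s ^ (N - 1))\<^sup>2 * (norm (G (x + s ^ N *\<^sub>R v)))\<^sup>2))"
  proof (intro integral_le integrable_continuous_real continuous_intros cf cG)
    fix s
    have "\<bar>v \<bullet> G (x + s ^ N *\<^sub>R v)\<bar> \<le> 2 * norm (G (x + s ^ N *\<^sub>R v))"
      using Cauchy_Schwarz_ineq2[of v "G (x + s ^ N *\<^sub>R v)"] \<open>norm v \<le> 2\<close>
      by (meson mult_right_mono norm_ge_zero order_trans)
    then have "(v \<bullet> G (x + s ^ N *\<^sub>R v))\<^sup>2 \<le> (2 * norm (G (x + s ^ N *\<^sub>R v)))\<^sup>2"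
      by (metis abs_ge_zero power2_abs power_mono)
    then have "(N * s ^ (N - 1))\<^sup>2 * (v \<bullet> G (x + s ^ N *\<^sub>R v))\<^sup>2
        \<le> (N * s ^ (N - 1))\<^sup>2 * (2 * norm (G (x + s ^ N *\<^sub>R v)))\<^sup>2"
      by (intro mult_left_mono) auto
    then show "(f s)\<^sup>2 \<le> 4 * (real N)\<^sup>2 * ((s ^ (N - 1))\<^sup>2 * (norm (G (x + s ^ N *\<^sub>R v)))\<^sup>2)"
      by (simp add: f_def power_mult_distrib mult_ac)
  qed
  also have "\<dots> = 4 * (real N)\<^sup>2 * integral {0..\<eta>} (\<lambda>s. (s ^ (N - 1))\<^sup>2 * (norm (G (x + s ^ N *\<^sub>R v)))\<^sup>2)"
    by simp
  finally show ?thesis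
    using \<open>\<eta> \<ge> 0\<close> by (simp add: mult_left_mono mult_right_mono mult_ac)
qed

section \<open>Integrals of a potential against shifted functions\<close>

lemma nn_integral_lborel_translate:
  fixes g :: "'a::euclidean_space \<Rightarrow> ennreal"
  assumes [measurable]: "g \<in> borel_measurable borel"
  shows "(\<integral>\<^sup>+x. g (x + a) \<partial>lborel) = (\<integral>\<^sup>+x. g x \<partial>lborel)"
proof -
  have "(\<integral>\<^sup>+x. g x \<partial>lborel) = (\<integral>\<^sup>+x. g x \<partial>distr lborel borel ((+) a))"
    by (simp add: lborel_distr_plus)
  also have "\<dots> = (\<integral>\<^sup>+x. g (x + a) \<partial>lborel)"
    by (simp add: nn_integral_distr add.commute)
  finally show ?thesis
    by simp
qed

lemma nn_integral_lborel_affine: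
  fixes g :: "'a::euclidean_space \<Rightarrow> ennreal"
  assumes [measurable]: "g \<in> borel_measurable borel" and "\<tau> > 0"
  shows "(\<integral>\<^sup>+v. g (x + \<tau> *\<^sub>R v) \<partial>lborel) = ennreal (1 / \<tau> ^ DIM('a)) * (\<integral>\<^sup>+y. g y \<partial>lborel)"
proof -
  have "(\<integral>\<^sup>+y. g y \<partial>lborel) = (\<integral>\<^sup>+y. g y \<partial>density (distr lborel borel (\<lambda>v. x + \<tau> *\<^sub>R v)) (\<lambda>_. ennreal (\<bar>\<tau>\<bar>^DIM('a))))"
    using \<open>\<tau> > 0\<close> by (subst lborel_affine[of \<tau> x]) auto
  also have "\<dots> = ennreal (\<tau> ^ DIM('a)) * (\<integral>\<^sup>+v. g (x + \<tau> *\<^sub>R v) \<partial>lborel)"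
    using \<open>\<tau> > 0\<close> by (simp add: nn_integral_density nn_integral_distr nn_integral_cmult)
  finally show ?thesis
    using \<open>\<tau> > 0\<close> by (simp add: mult.assoc[symmetric] ennreal_mult[symmetric])
qed

text \<open>The two parts of the bound on \<open>V\<close> are integrated in different orders. With
  \<open>a * \<Phi> x\<close>, the variable \<open>v\<close> comes first and ranges over the whole
  space, which costs the Jacobian \<open>1 / \<tau> ^ DIM('a)\<close>. With the constant
  \<open>b\<close>, the variable \<open>x\<close> comes first, and translation invariance leaves
  only the measure of \<open>B\<close>.\<close>

lemma nn_integral_shift_kernel_le:
  fixes g V \<Phi> :: "'a::euclidean_space \<Rightarrow> ennreal" and B :: "'a set"
  assumes [measurable]: "g \<in> borel_measurable borel" "\<Phi> \<in> borel_measurable borel" "B \<in> sets borel"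
    and V: "\<And>x. V x \<le> a * \<Phi> x + b" and "\<tau> > 0"
  shows "(\<integral>\<^sup>+x. \<integral>\<^sup>+v. indicator B v * (V x * g (x + \<tau> *\<^sub>R v)) \<partial>lborel \<partial>lborel)
    \<le> (a * ennreal (1 / \<tau> ^ DIM('a)) * (\<integral>\<^sup>+x. \<Phi> x \<partial>lborel) + b * emeasure lborel B) * (\<integral>\<^sup>+y. g y \<partial>lborel)"
proof -
  let ?g = "\<integral>\<^sup>+y. g y \<partial>lborel"
  have "(\<integral>\<^sup>+x. \<integral>\<^sup>+v. indicator B v * (V x * g (x + \<tau> *\<^sub>R v)) \<partial>lborel \<partial>lborel)
     \<le> (\<integral>\<^sup>+x. \<integral>\<^sup>+v. a * \<Phi> x * g (x + \<tau> *\<^sub>R v) + b * (indicator B v * g (x + \<tau> *\<^sub>R v)) \<partial>lborel \<partial>lborel)"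
  proof (intro nn_integral_mono)
    fix x v :: 'a
    have "V x * g (x + \<tau> *\<^sub>R v) \<le> (a * \<Phi> x + b) * g (x + \<tau> *\<^sub>R v)"
      by (rule mult_right_mono[OF V]) simp
    then show "indicator B v * (V x * g (x + \<tau> *\<^sub>R v))
        \<le> a * \<Phi> x * g (x + \<tau> *\<^sub>R v) + b * (indicator B v * g (x + \<tau> *\<^sub>R v))"
      by (cases "v \<in> B") (auto simp: distrib_right mult.assoc)
  qed
  also have "\<dots> = (\<integral>\<^sup>+x. a * \<Phi> x * (ennreal (1 / \<tau> ^ DIM('a)) * ?g) \<partial>lborel)
      + b * (\<integral>\<^sup>+x. \<integral>\<^sup>+v. indicator B v * g (x + \<tau> *\<^sub>R v) \<partial>lborel \<partial>lborel)"
    by (simp add: nn_integral_add nn_integral_cmult nn_integral_lborel_affine \<open>\<tau> > 0\<close>)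
  also have "(\<integral>\<^sup>+x. \<integral>\<^sup>+v. indicator B v * g (x + \<tau> *\<^sub>R v) \<partial>lborel \<partial>lborel)
      = (\<integral>\<^sup>+v. \<integral>\<^sup>+x. indicator B v * g (x + \<tau> *\<^sub>R v) \<partial>lborel \<partial>lborel)"
    by (rule lborel_pair.Fubini') measurable
  also have "\<dots> = emeasure lborel B * ?g"
    by (simp add: nn_integral_cmult nn_integral_lborel_translate nn_integral_multc)
  also have "(\<integral>\<^sup>+x. a * \<Phi> x * (ennreal (1 / \<tau> ^ DIM('a)) * ?g) \<partial>lborel)
      = a * ennreal (1 / \<tau> ^ DIM('a)) * (\<integral>\<^sup>+x. \<Phi> x \<partial>lborel) * ?g"
    by (simp add: nn_integral_cmult nn_integral_multc mult_ac)
  finally show ?thesis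
    by (simp add: distrib_right mult.assoc)
qed

text \<open>Links the real set integrals of the final estimate to extended nonnegative ones, in
  which Fubini is applied freely.\<close>

lemma nn_integral_eq_set_integral:
  fixes f :: "'a \<Rightarrow> real"
  assumes "set_integrable M S f" and "\<And>x. x \<in> S \<Longrightarrow> 0 \<le> f x"
  shows "(\<integral>\<^sup>+x. indicator S x * ennreal (f x) \<partial>M) = ennreal (LINT x:S|M. f x)"
proof -
  have "(\<integral>\<^sup>+x. indicator S x * ennreal (f x) \<partial>M) = (\<integral>\<^sup>+x. ennreal (indicator S x *\<^sub>R f x) \<partial>M)"
    by (intro nn_integral_cong) (auto simp: indicator_def)
  also have "\<dots> = ennreal (LINT x:S|M. f x)"
    using assms unfolding set_lebesgue_integral_def set_integrable_def
    by (intro nn_integral_eq_integral) (auto simp: indicator_def)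
  finally show ?thesis .
qed

text \<open>Truncate at a level \<open>c\<close>: below it \<open>\<Phi> x powr \<theta>\<close> is
  at most \<open>c powr \<theta>\<close>, above it at most
  \<open>c powr (\<theta> - 1) * \<Phi> x\<close> because \<open>\<theta> < 1\<close>. Only the
  unbounded part pays the Jacobian, and the choice of \<open>c\<close> weakens the singularity in
  \<open>\<tau>\<close> from exponent \<open>DIM('a)\<close> to
  \<open>DIM('a) * \<theta>\<close>.\<close>

lemma nn_integral_shift_powr_le:
  fixes \<Phi> :: "'a::euclidean_space \<Rightarrow> real" and g :: "'a \<Rightarrow> ennreal" and B :: "'a set"
    and m \<theta> \<tau> :: real
  assumes [measurable]: "g \<in> borel_measurable borel" "\<Phi> \<in> borel_measurable borel" "B \<in> sets borel"
    and "bounded B" and \<Phi>: "\<And>x. \<Phi> x \<ge> 0" and m: "(\<integral>\<^sup>+x. ennreal (\<Phi> x) \<partial>lborel) \<le> ennreal m" "m > 0"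
    and \<theta>: "0 < \<theta>" "\<theta> < 1" and "\<tau> > 0"
  shows "(\<integral>\<^sup>+x. \<integral>\<^sup>+v. indicator B v * (ennreal (\<Phi> x powr \<theta>) * g (x + \<tau> *\<^sub>R v)) \<partial>lborel \<partial>lborel)
    \<le> ennreal (m powr \<theta> * (1 + measure lborel B) * \<tau> powr (- real DIM('a) * \<theta>)) * (\<integral>\<^sup>+y. g y \<partial>lborel)"
proof -
  \<comment> \<open>This level balances the two terms of the pointwise bound below.\<close>
  define c where "c = m * \<tau> powr (- real DIM('a))"
  have "c > 0"
    using m \<open>\<tau> > 0\<close> by (simp add: c_def)
  have pointwise: "\<Phi> x powr \<theta> \<le> c powr (\<theta> - 1) * \<Phi> x + c powr \<theta>" for x
  proof (cases "\<Phi> x \<le> c")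
    case True
    then have "\<Phi> x powr \<theta> \<le> c powr \<theta>"
      using \<Phi> \<theta> by (intro powr_mono2) auto
    moreover have "0 \<le> c powr (\<theta> - 1) * \<Phi> x"
      using \<Phi> by simp
    ultimately show ?thesis
      by linarith
  next
    case False
    then have "\<Phi> x powr (\<theta> - 1) \<le> c powr (\<theta> - 1)"
      using \<open>c > 0\<close> \<theta> by (intro powr_mono2') auto
    then have "\<Phi> x powr (\<theta> - 1) * \<Phi> x \<le> c powr (\<theta> - 1) * \<Phi> x"
      using \<Phi> by (intro mult_right_mono) auto
    moreover have "\<Phi> x powr (\<theta> - 1) * \<Phi> x = \<Phi> x powr \<theta>"
      using False \<open>c > 0\<close> powr_mult_base[of "\<Phi> x" "\<theta> - 1"] by (simp add: mult.commute)
    ultimately show ?thesis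
      by (smt (verit) powr_ge_zero)
  qed
  have V: "ennreal (\<Phi> x powr \<theta>) \<le> ennreal (c powr (\<theta> - 1)) * ennreal (\<Phi> x) + ennreal (c powr \<theta>)" for x
    using pointwise[of x] \<Phi>[of x] by (simp add: ennreal_mult[symmetric] ennreal_plus[symmetric] del: ennreal_plus)
  have B: "emeasure lborel B = ennreal (measure lborel B)"
    using emeasure_bounded_finite[OF \<open>bounded B\<close>] by (intro emeasure_eq_ennreal_measure) auto
  have \<tau>: "1 / \<tau> ^ DIM('a) = \<tau> powr (- real DIM('a))"
    using \<open>\<tau> > 0\<close> by (simp add: powr_minus powr_realpow divide_inverse)
  let ?I = "ennreal (c powr (\<theta> - 1)) * ennreal (1 / \<tau> ^ DIM('a)) * (\<integral>\<^sup>+x. ennreal (\<Phi> x) \<partial>lborel)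
      + ennreal (c powr \<theta>) * emeasure lborel B"
  have "?I \<le> ennreal (c powr (\<theta> - 1)) * ennreal (1 / \<tau> ^ DIM('a)) * ennreal m
      + ennreal (c powr \<theta>) * emeasure lborel B"
    by (intro add_right_mono mult_left_mono m) simp
  also have "\<dots> = ennreal (c powr (\<theta> - 1) * c + c powr \<theta> * measure lborel B)"
    using \<open>c > 0\<close> m \<open>\<tau> > 0\<close>
    by (simp add: B \<tau> c_def ennreal_mult[symmetric] ennreal_plus[symmetric] mult_ac del: ennreal_plus)
  also have "c powr (\<theta> - 1) * c + c powr \<theta> * measure lborel B = c powr \<theta> * (1 + measure lborel B)"
    using \<open>c > 0\<close> powr_mult_base[of c "\<theta> - 1"] by (simp add: mult.commute distrib_left)
  also have "\<dots> = m powr \<theta> * (1 + measure lborel B) * \<tau> powr (- real DIM('a) * \<theta>)"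
    using m \<open>\<tau> > 0\<close> by (simp add: c_def powr_mult powr_powr)
  finally have "?I \<le> ennreal (m powr \<theta> * (1 + measure lborel B) * \<tau> powr (- real DIM('a) * \<theta>))" .
  moreover have "(\<integral>\<^sup>+x. \<integral>\<^sup>+v. indicator B v * (ennreal (\<Phi> x powr \<theta>) * g (x + \<tau> *\<^sub>R v)) \<partial>lborel \<partial>lborel)
      \<le> ?I * (\<integral>\<^sup>+y. g y \<partial>lborel)"
    using \<open>\<tau> > 0\<close> by (intro nn_integral_shift_kernel_le V) measurable
  ultimately show ?thesis
    by (meson mult_right_mono order_trans zero_le)
qed

section \<open>The form bound\<close>

text \<open>The ray bound is multiplied by the potential, averaged over the directions of the cone
  at \<open>x\<close> and integrated over \<open>x\<close>. Fubini moves \<open>s\<close> outermost,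
  and for each fixed \<open>s\<close> the shift estimate applies with dilation \<open>s ^ N\<close>.
  The condition on \<open>N\<close> makes the resulting power of \<open>s\<close> bounded.\<close>

lemma nn_integral_potential_le:
  fixes w \<Phi> :: "'a::euclidean_space \<Rightarrow> real" and G :: "'a \<Rightarrow> 'a" and \<Omega> :: "'a set" and N :: nat
    and m \<theta> d \<eta> :: real
  defines "W \<equiv> \<lambda>y. indicator \<Omega> y * ennreal ((w y)\<^sup>2)"
    and "g \<equiv> \<lambda>y. indicator \<Omega> y * ennreal ((norm (G y))\<^sup>2)"
    and "K \<equiv> \<lambda>m \<theta> :: real. m powr \<theta> * (1 + measure lborel (cball (0::'a) 2))"
  assumes "open \<Omega>" and d: "0 < d" "d \<le> 1" and cone: "\<And>x. x \<in> \<Omega> \<Longrightarrow> cone_at d \<Omega> x"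
    and contG: "continuous_on \<Omega> G" and G: "\<And>y. y \<in> \<Omega> \<Longrightarrow> GDERIV w y :> G y"
    and \<Phi>_measurable[measurable]: "\<Phi> \<in> borel_measurable borel"
    and \<Phi>: "\<And>x. \<Phi> x \<ge> 0" and m: "(\<integral>\<^sup>+x. ennreal (\<Phi> x) \<partial>lborel) \<le> ennreal m" "m > 0"
    and \<theta>: "0 < \<theta>" "\<theta> < 1" and \<eta>: "0 < \<eta>" "\<eta> \<le> d" and N: "N \<ge> 1" "real N * (2 - real DIM('a) * \<theta>) \<ge> 2"
  shows "ennreal (measure lborel (ball (0::'a) d)) * (\<integral>\<^sup>+x. ennreal (\<Phi> x powr \<theta>) * W x \<partial>lborel)
    \<le> ennreal (8 * (real N)\<^sup>2 * \<eta>\<^sup>2 * K m \<theta>) * (\<integral>\<^sup>+x. g x \<partial>lborel)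
      + ennreal (2 * K m \<theta> * (\<eta> ^ N) powr (- real DIM('a) * \<theta>)) * (\<integral>\<^sup>+x. W x \<partial>lborel)"
proof -
  define V where "V x = ennreal (\<Phi> x powr \<theta>)" for x
  \<comment> \<open>Every direction of every cone lies in \<open>B\<close>, since the axis has norm
    at most 1 and \<open>d \<le> 1\<close>. This set does not depend on \<open>x\<close>, as Fubini
    requires.\<close>
  define B where "B = cball (0::'a) 2"
  let ?h = "\<lambda>s x v. indicator {0..\<eta>} s * (ennreal ((s ^ (N - 1))\<^sup>2) * g (x + s ^ N *\<^sub>R v))"
  define c where "c = ennreal (8 * (real N)\<^sup>2 * \<eta>)"
  have K: "K m \<theta> \<ge> 0"
    by (simp add: K_def)
  have \<Omega>_borel[measurable]: "\<Omega> \<in> sets borel"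
    using \<open>open \<Omega>\<close> by simp
  have cont_w: "continuous_on \<Omega> w"
    using G by (meson continuous_at_imp_continuous_on gderiv_def has_derivative_continuous)
  have W_eq: "W = (\<lambda>y. ennreal (indicator \<Omega> y *\<^sub>R (w y)\<^sup>2))" and g_eq: "g = (\<lambda>y. ennreal (indicator \<Omega> y *\<^sub>R (norm (G y))\<^sup>2))"
    by (auto simp: W_def g_def indicator_def)
  have [measurable]: "W \<in> borel_measurable borel"
    unfolding W_eq
    by (intro measurable_compose[OF borel_measurable_continuous_on_indicator measurable_ennreal] continuous_intros cont_w \<Omega>_borel)
  have [measurable]: "g \<in> borel_measurable borel"
    unfolding g_eq
    by (intro measurable_compose[OF borel_measurable_continuous_on_indicator measurable_ennreal] continuous_intros contG \<Omega>_borel)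
  have [measurable]: "V \<in> borel_measurable borel"
    unfolding V_def by measurable
  have [measurable]: "B \<in> sets borel"
    by (simp add: B_def)
  have pointwise: "W x \<le> 2 * W (x + \<eta> ^ N *\<^sub>R v) + c * (\<integral>\<^sup>+s. ?h s x v \<partial>lborel)"
    if x: "x \<in> \<Omega>" and ray: "\<And>t. t \<in> {0..d} \<Longrightarrow> x + t *\<^sub>R v \<in> \<Omega>" and "norm v \<le> 2" for x v
  proof -
    have "\<eta> ^ N \<le> \<eta> ^ 1"
      using \<eta> d N by (intro power_decreasing) auto
    then have ray': "x + t *\<^sub>R v \<in> \<Omega>" if "t \<in> {0..\<eta> ^ N}" for t
      using that \<eta> by (intro ray) auto
    let ?f = "\<lambda>s. (s ^ (N - 1))\<^sup>2 * (norm (G (x + s ^ N *\<^sub>R v)))\<^sup>2"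
    have in_\<Omega>: "x + s ^ N *\<^sub>R v \<in> \<Omega>" if "s \<in> {0..\<eta>}" for s
      using that by (intro ray') (auto intro: power_mono)
    have "continuous_on {0..\<eta>} (\<lambda>s. G (x + s ^ N *\<^sub>R v))"
      using in_\<Omega> by (intro continuous_on_compose2[OF contG] continuous_intros) auto
    then have "set_integrable lborel {0..\<eta>} ?f"
      by (intro borel_integrable_atLeastAtMost' continuous_intros)
    note f = nn_integral_eq_set_integral[OF this] set_borel_integral_eq_integral(2)[OF this]
    have "(\<integral>\<^sup>+s. ?h s x v \<partial>lborel) = (\<integral>\<^sup>+s. indicator {0..\<eta>} s * ennreal (?f s) \<partial>lborel)"
      using in_\<Omega> by (intro nn_integral_cong) (auto simp: g_def indicator_def ennreal_mult)
    also have "\<dots> = ennreal (integral {0..\<eta>} ?f)"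
      using f by simp
    finally have int_h: "(\<integral>\<^sup>+s. ?h s x v \<partial>lborel) = ennreal (integral {0..\<eta>} ?f)" .
    have f_nonneg: "integral {0..\<eta>} ?f \<ge> 0"
      by (rule Henstock_Kurzweil_Integration.integral_nonneg) (use \<open>set_integrable lborel {0..\<eta>} ?f\<close> in \<open>auto intro: set_borel_integral_eq_integral(1)\<close>)
    have "(w x)\<^sup>2 \<le> 2 * (w (x + \<eta> ^ N *\<^sub>R v))\<^sup>2 + 8 * (real N)\<^sup>2 * \<eta> * integral {0..\<eta>} ?f"
      using \<eta> N \<open>norm v \<le> 2\<close> by (intro ray_square_bound[OF contG G ray']) auto
    then have "ennreal ((w x)\<^sup>2) \<le> ennreal (2 * (w (x + \<eta> ^ N *\<^sub>R v))\<^sup>2 + 8 * (real N)\<^sup>2 * \<eta> * integral {0..\<eta>} ?f)"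
      by (rule ennreal_leI)
    also have "\<dots> = 2 * ennreal ((w (x + \<eta> ^ N *\<^sub>R v))\<^sup>2) + c * (\<integral>\<^sup>+s. ?h s x v \<partial>lborel)"
      unfolding int_h using \<eta> f_nonneg by (simp add: c_def ennreal_mult)
    finally show ?thesis
      using x in_\<Omega>[of \<eta>] \<eta> by (simp add: W_def)
  qed
  \<comment> \<open>The axis varies with \<open>x\<close>, but the measure of the ball of directions
    does not. Outside \<open>\<Omega>\<close> the left side vanishes.\<close>
  have local: "emeasure lborel (ball (0::'a) d) * (V x * W x)
      \<le> (\<integral>\<^sup>+v. indicator B v * (V x * (2 * W (x + \<eta> ^ N *\<^sub>R v) + c * (\<integral>\<^sup>+s. ?h s x v \<partial>lborel))) \<partial>lborel)" for x
  proof (cases "x \<in> \<Omega>")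
    case True
    then obtain \<nu> where "norm \<nu> \<le> 1" and ray: "\<And>v t. v \<in> ball \<nu> d \<Longrightarrow> t \<in> {0..d} \<Longrightarrow> x + t *\<^sub>R v \<in> \<Omega>"
      using cone unfolding cone_at_def by blast
    have norm_v: "norm v \<le> 2" if "v \<in> ball \<nu> d" for v
      using that \<open>norm \<nu> \<le> 1\<close> d norm_triangle_ineq[of \<nu> "v - \<nu>"]
      by (simp add: dist_norm norm_minus_commute)
    have "emeasure lborel (ball (0::'a) d) = emeasure lborel (ball \<nu> d)"
      using d by (simp add: emeasure_ball)
    then have "emeasure lborel (ball (0::'a) d) * (V x * W x) = (\<integral>\<^sup>+v. indicator (ball \<nu> d) v * (V x * W x) \<partial>lborel)"
      by (subst nn_integral_multc) (auto intro: borel_measurable_indicator)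
    also have "\<dots> \<le> (\<integral>\<^sup>+v. indicator B v * (V x * (2 * W (x + \<eta> ^ N *\<^sub>R v) + c * (\<integral>\<^sup>+s. ?h s x v \<partial>lborel))) \<partial>lborel)"
    proof (rule nn_integral_mono)
      fix v
      show "indicator (ball \<nu> d) v * (V x * W x)
        \<le> indicator B v * (V x * (2 * W (x + \<eta> ^ N *\<^sub>R v) + c * (\<integral>\<^sup>+s. ?h s x v \<partial>lborel)))"
      proof (cases "v \<in> ball \<nu> d")
        case v: True
        then have "v \<in> B"
          using norm_v by (simp add: B_def)
        then show ?thesis
          using v pointwise[OF True ray norm_v] by (simp add: mult_left_mono)
      qed simp
    qed
    finally show ?thesis .
  qed (simp add: W_def)
  have "emeasure lborel (ball (0::'a) d) * (\<integral>\<^sup>+x. V x * W x \<partial>lborel)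
      = (\<integral>\<^sup>+x. emeasure lborel (ball (0::'a) d) * (V x * W x) \<partial>lborel)"
    by (simp add: nn_integral_cmult)
  also have "\<dots> \<le> (\<integral>\<^sup>+x. \<integral>\<^sup>+v. indicator B v * (V x * (2 * W (x + \<eta> ^ N *\<^sub>R v) + c * (\<integral>\<^sup>+s. ?h s x v \<partial>lborel))) \<partial>lborel \<partial>lborel)"
    by (rule nn_integral_mono) (rule local)
  also have "\<dots> = (\<integral>\<^sup>+x. \<integral>\<^sup>+v. 2 * (indicator B v * (V x * W (x + \<eta> ^ N *\<^sub>R v)))
      + c * (\<integral>\<^sup>+s. indicator B v * (V x * ?h s x v) \<partial>lborel) \<partial>lborel \<partial>lborel)"
  \<comment> \<open>The potential and the indicator are pulled into the integral over
    \<open>s\<close>, so that the order of integration can be changed.\<close>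
  proof -
    have "(\<integral>\<^sup>+s. indicator B v * (V x * ?h s x v) \<partial>lborel) = indicator B v * (V x * (\<integral>\<^sup>+s. ?h s x v \<partial>lborel))" for x v
      by (simp add: nn_integral_cmult)
    then show ?thesis
      by (simp add: distrib_left mult_ac)
  qed
  also have "\<dots> = 2 * (\<integral>\<^sup>+x. \<integral>\<^sup>+v. indicator B v * (V x * W (x + \<eta> ^ N *\<^sub>R v)) \<partial>lborel \<partial>lborel)
      + c * (\<integral>\<^sup>+x. \<integral>\<^sup>+v. \<integral>\<^sup>+s. indicator B v * (V x * ?h s x v) \<partial>lborel \<partial>lborel \<partial>lborel)"
    by (simp add: nn_integral_add nn_integral_cmult)
  also have "(\<integral>\<^sup>+x. \<integral>\<^sup>+v. \<integral>\<^sup>+s. indicator B v * (V x * ?h s x v) \<partial>lborel \<partial>lborel \<partial>lborel)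
      = (\<integral>\<^sup>+x. \<integral>\<^sup>+s. \<integral>\<^sup>+v. indicator B v * (V x * ?h s x v) \<partial>lborel \<partial>lborel \<partial>lborel)"
    by (intro nn_integral_cong lborel_pair.Fubini') measurable
  also have "\<dots> = (\<integral>\<^sup>+s. \<integral>\<^sup>+x. \<integral>\<^sup>+v. indicator B v * (V x * ?h s x v) \<partial>lborel \<partial>lborel \<partial>lborel)"
    by (rule lborel_pair.Fubini') measurable
  also have "\<dots> \<le> (\<integral>\<^sup>+s. indicator {0..\<eta>} s * (ennreal (K m \<theta>) * (\<integral>\<^sup>+y. g y \<partial>lborel)) \<partial>lborel)"
  proof (rule nn_integral_mono_AE, rule AE_mp[OF AE_lborel_singleton[of 0]], rule AE_I2, rule impI)
    \<comment> \<open>The null set \<open>s = 0\<close> is discarded because the shift estimate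
      needs a positive dilation \<open>s ^ N\<close>.\<close>
    fix s :: real assume "s \<noteq> 0"
    show "(\<integral>\<^sup>+x. \<integral>\<^sup>+v. indicator B v * (V x * ?h s x v) \<partial>lborel \<partial>lborel)
        \<le> indicator {0..\<eta>} s * (ennreal (K m \<theta>) * (\<integral>\<^sup>+y. g y \<partial>lborel))"
    proof (cases "s \<in> {0..\<eta>}")
      case True
      then have s: "0 < s" "s \<le> 1"
        using \<open>s \<noteq> 0\<close> \<eta> d by auto
      \<comment> \<open>The weight from the speed of the curve meets the singularity of the shift
        estimate. Their product has exponent
        \<open>N * (2 - DIM('a) * \<theta>) - 2 \<ge> 0\<close>, hence is at most 1 for
        \<open>s \<le> 1\<close>.\<close>
      have "(s ^ (N - 1))\<^sup>2 * (s ^ N) powr (- real DIM('a) * \<theta>) = s powr (2 * (real N - 1)) * s powr (real N * (- real DIM('a) * \<theta>))"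
        using s N by (simp add: powr_realpow[symmetric] powr_powr of_nat_diff mult_ac)
      also have "\<dots> = s powr (real N * (2 - real DIM('a) * \<theta>) - 2)"
        by (simp add: powr_add[symmetric] algebra_simps)
      also have "\<dots> \<le> 1"
        using s N by (intro powr_le1) auto
      finally have "K m \<theta> * ((s ^ (N - 1))\<^sup>2 * (s ^ N) powr (- real DIM('a) * \<theta>)) \<le> K m \<theta>"
        using K by (metis mult_left_mono mult.right_neutral)
      then have le: "ennreal ((s ^ (N - 1))\<^sup>2) * ennreal (K m \<theta> * (s ^ N) powr (- real DIM('a) * \<theta>)) \<le> ennreal (K m \<theta>)"
        using K by (simp add: ennreal_mult[symmetric] mult_ac)
      have "(\<integral>\<^sup>+x. \<integral>\<^sup>+v. indicator B v * (V x * ?h s x v) \<partial>lborel \<partial>lborel)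
          = (\<integral>\<^sup>+x. \<integral>\<^sup>+v. ennreal ((s ^ (N - 1))\<^sup>2) * (indicator B v * (V x * g (x + s ^ N *\<^sub>R v))) \<partial>lborel \<partial>lborel)"
        using True by (simp add: mult_ac)
      also have "\<dots> = ennreal ((s ^ (N - 1))\<^sup>2) * (\<integral>\<^sup>+x. \<integral>\<^sup>+v. indicator B v * (V x * g (x + s ^ N *\<^sub>R v)) \<partial>lborel \<partial>lborel)"
        by (simp add: nn_integral_cmult)
      also have "\<dots> \<le> ennreal ((s ^ (N - 1))\<^sup>2) * (ennreal (K m \<theta> * (s ^ N) powr (- real DIM('a) * \<theta>)) * (\<integral>\<^sup>+y. g y \<partial>lborel))"
        unfolding V_def K_def B_def using s \<Phi> m \<theta>
        by (intro mult_left_mono nn_integral_shift_powr_le) auto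
      also have "\<dots> \<le> ennreal (K m \<theta>) * (\<integral>\<^sup>+y. g y \<partial>lborel)"
        unfolding mult.assoc[symmetric] by (intro mult_right_mono le) simp
      finally show ?thesis
        using True by simp
    qed simp
  qed
  \<comment> \<open>The length of the interval supplies a second factor \<open>\<eta>\<close>
    besides the one in \<open>c\<close>; the resulting square makes the gradient term small.\<close>
  also have "\<dots> = ennreal \<eta> * (ennreal (K m \<theta>) * (\<integral>\<^sup>+y. g y \<partial>lborel))"
    using \<eta> by (simp add: nn_integral_multc)
  also have "(\<integral>\<^sup>+x. \<integral>\<^sup>+v. indicator B v * (V x * W (x + \<eta> ^ N *\<^sub>R v)) \<partial>lborel \<partial>lborel)
      \<le> ennreal (K m \<theta> * (\<eta> ^ N) powr (- real DIM('a) * \<theta>)) * (\<integral>\<^sup>+y. W y \<partial>lborel)"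
    unfolding V_def K_def B_def using \<eta> \<Phi> m \<theta>
    by (intro nn_integral_shift_powr_le) auto
  finally have bound: "emeasure lborel (ball (0::'a) d) * (\<integral>\<^sup>+x. V x * W x \<partial>lborel)
      \<le> 2 * (ennreal (K m \<theta> * (\<eta> ^ N) powr (- real DIM('a) * \<theta>)) * (\<integral>\<^sup>+y. W y \<partial>lborel))
        + c * (ennreal \<eta> * (ennreal (K m \<theta>) * (\<integral>\<^sup>+y. g y \<partial>lborel)))"
    by (simp add: add_mono mult_left_mono)
  have 1: "c * (ennreal \<eta> * (ennreal (K m \<theta>) * I)) = ennreal (8 * (real N)\<^sup>2 * \<eta>\<^sup>2 * K m \<theta>) * I" for I
    using \<eta> K by (simp add: c_def ennreal_mult power2_eq_square mult_ac)
  have 2: "2 * (ennreal (K m \<theta> * (\<eta> ^ N) powr (- real DIM('a) * \<theta>)) * I) = ennreal (2 * K m \<theta> * (\<eta> ^ N) powr (- real DIM('a) * \<theta>)) * I" for I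
    using K by (simp add: ennreal_mult mult_ac)
  have 3: "emeasure lborel (ball (0::'a) d) = ennreal (measure lborel (ball (0::'a) d))"
    using emeasure_lborel_ball_finite[of "0::'a" d] by (intro emeasure_eq_ennreal_measure) auto
  show ?thesis
    using bound unfolding 1 2 3 V_def by (simp add: add.commute)
qed

lemma set_integrable_continuous_on_closure:
  fixes f :: "'a::euclidean_space \<Rightarrow> real"
  assumes "open S" and "bounded S" and "continuous_on (closure S) f"
  shows "set_integrable lborel S f"
proof (rule set_integrable_subset)
  show "set_integrable lborel (closure S) f"
    unfolding set_integrable_def using assms by (intro borel_integrable_compact) auto
qed (use assms closure_subset in auto)

text \<open>Fix \<open>N\<close> by the exponent condition, then take \<open>\<eta>\<close> so small
  that the gradient coefficient, divided by the measure \<open>b\<close> of the ball of directions,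
  is at most \<open>\<epsilon>\<close>. These choices involve only \<open>d\<close>,
  \<open>\<theta>\<close>, \<open>m\<close>, \<open>\<epsilon>\<close> and the space, so
  \<open>C\<close> is uniform in the functions.\<close>

lemma integral_potential_le:
  fixes \<Omega> :: "'a::euclidean_space set" and \<theta> m \<epsilon> d :: real
  assumes "open \<Omega>" and "bounded \<Omega>" and d: "0 < d" "d \<le> 1" and cone: "\<And>x. x \<in> \<Omega> \<Longrightarrow> cone_at d \<Omega> x"
    and \<theta>: "0 < \<theta>" "\<theta> < 1" "DIM('a) * \<theta> < 2" and "m > 0" and "\<epsilon> > 0"
  shows "\<exists>C>0. \<forall>(\<phi> :: 'a \<Rightarrow> real) w G.
    continuous_on (closure \<Omega>) \<phi> \<longrightarrow> (\<forall>x\<in>closure \<Omega>. \<phi> x > 0) \<longrightarrow> (LINT x:\<Omega>|lborel. \<phi> x) \<le> m \<longrightarrow>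
    continuous_on (closure \<Omega>) w \<longrightarrow> continuous_on (closure \<Omega>) G \<longrightarrow> (\<forall>y\<in>\<Omega>. GDERIV w y :> G y) \<longrightarrow>
    (LINT x:\<Omega>|lborel. \<phi> x powr \<theta> * (w x)\<^sup>2)
      \<le> \<epsilon> * (LINT x:\<Omega>|lborel. (norm (G x))\<^sup>2) + C * (LINT x:\<Omega>|lborel. (w x)\<^sup>2)"
proof -
  define b where "b = measure lborel (ball (0::'a) d)"
  have "b > 0"
    using d by (simp add: b_def content_ball_pos)
  define K where "K = m powr \<theta> * (1 + measure lborel (cball (0::'a) 2))"
  have "K > 0"
    using \<open>m > 0\<close> by (simp add: K_def add_pos_nonneg)
  define N where "N = Suc (nat \<lceil>2 / (2 - DIM('a) * \<theta>)\<rceil>)"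
  have "N \<ge> 1"
    by (simp add: N_def)
  have "2 / (2 - DIM('a) * \<theta>) \<le> real N"
    unfolding N_def by linarith
  then have N: "real N * (2 - real DIM('a) * \<theta>) \<ge> 2"
    using \<theta> by (simp add: pos_divide_le_eq)
  \<comment> \<open>The square root solves
    \<open>8 * N\<^sup>2 * \<eta>\<^sup>2 * K = \<epsilon> * b\<close>; the minimum with
    \<open>d\<close> keeps the curve within the cone.\<close>
  define \<eta> where "\<eta> = min d (sqrt (\<epsilon> * b / (8 * (real N)\<^sup>2 * K)))"
  have pos: "\<epsilon> * b / (8 * (real N)\<^sup>2 * K) > 0"
    using \<open>\<epsilon> > 0\<close> \<open>b > 0\<close> \<open>K > 0\<close> \<open>N \<ge> 1\<close> by simp
  then have \<eta>: "0 < \<eta>" "\<eta> \<le> d"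
    using d by (auto simp: \<eta>_def)
  have "\<eta>\<^sup>2 \<le> (sqrt (\<epsilon> * b / (8 * (real N)\<^sup>2 * K)))\<^sup>2"
    using \<eta>(1) by (intro power_mono) (auto simp: \<eta>_def)
  then have \<eta>_sq: "8 * (real N)\<^sup>2 * \<eta>\<^sup>2 * K \<le> \<epsilon> * b"
    using pos \<open>K > 0\<close> \<open>N \<ge> 1\<close> by (simp add: field_simps)
  define C where "C = 2 * K * (\<eta> ^ N) powr (- real DIM('a) * \<theta>) / b"
  have "C > 0"
    using \<open>b > 0\<close> \<open>K > 0\<close> \<eta> by (simp add: C_def)
  have "(LINT x:\<Omega>|lborel. \<phi> x powr \<theta> * (w x)\<^sup>2)
      \<le> \<epsilon> * (LINT x:\<Omega>|lborel. (norm (G x))\<^sup>2) + C * (LINT x:\<Omega>|lborel. (w x)\<^sup>2)"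
    if cont: "continuous_on (closure \<Omega>) \<phi>" "continuous_on (closure \<Omega>) w" "continuous_on (closure \<Omega>) G"
      and \<phi>: "\<And>x. x \<in> closure \<Omega> \<Longrightarrow> \<phi> x > 0" and le_m: "(LINT x:\<Omega>|lborel. \<phi> x) \<le> m"
      and G: "\<And>y. y \<in> \<Omega> \<Longrightarrow> GDERIV w y :> G y" for \<phi> :: "'a \<Rightarrow> real" and w G
  proof -
    \<comment> \<open>Extension by zero gives a Borel function on the whole space whose total mass
      is still at most \<open>m\<close>.\<close>
    define \<Phi> where "\<Phi> x = indicator \<Omega> x *\<^sub>R \<phi> x" for x
    note int = set_integrable_continuous_on_closure[OF \<open>open \<Omega>\<close> \<open>bounded \<Omega>\<close>]
    have \<phi>': "\<phi> x > 0" if "x \<in> \<Omega>" for x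
      using \<phi> that closure_subset by blast
    have \<Phi>_measurable: "\<Phi> \<in> borel_measurable borel"
      unfolding \<Phi>_def using \<open>open \<Omega>\<close> continuous_on_subset[OF cont(1) closure_subset]
      by (intro borel_measurable_continuous_on_indicator) auto
    have \<Phi>_nonneg: "\<Phi> x \<ge> 0" for x
      using \<phi>' by (simp add: \<Phi>_def indicator_def less_imp_le)
    have "(\<integral>\<^sup>+x. ennreal (\<Phi> x) \<partial>lborel) = (\<integral>\<^sup>+x. indicator \<Omega> x * ennreal (\<phi> x) \<partial>lborel)"
      by (intro nn_integral_cong) (simp add: \<Phi>_def indicator_def)
    also have "\<dots> = ennreal (LINT x:\<Omega>|lborel. \<phi> x)"
      using \<phi>' by (intro nn_integral_eq_set_integral int cont) (auto intro: less_imp_le)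
    also have "\<dots> \<le> ennreal m"
      using le_m by (rule ennreal_leI)
    finally have \<Phi>_le: "(\<integral>\<^sup>+x. ennreal (\<Phi> x) \<partial>lborel) \<le> ennreal m" .
    define X where "X = (LINT x:\<Omega>|lborel. \<phi> x powr \<theta> * (w x)\<^sup>2)"
    define Y where "Y = (LINT x:\<Omega>|lborel. (norm (G x))\<^sup>2)"
    define Z where "Z = (LINT x:\<Omega>|lborel. (w x)\<^sup>2)"
    have nonneg: "X \<ge> 0" "Y \<ge> 0" "Z \<ge> 0"
      unfolding X_def Y_def Z_def set_lebesgue_integral_def by auto
    have "(\<integral>\<^sup>+x. ennreal (\<Phi> x powr \<theta>) * (indicator \<Omega> x * ennreal ((w x)\<^sup>2)) \<partial>lborel)
        = (\<integral>\<^sup>+x. indicator \<Omega> x * ennreal (\<phi> x powr \<theta> * (w x)\<^sup>2) \<partial>lborel)"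
      by (intro nn_integral_cong) (simp add: \<Phi>_def indicator_def ennreal_mult)
    also have "\<dots> = ennreal X"
      unfolding X_def using \<theta> \<phi>
      by (intro nn_integral_eq_set_integral int continuous_intros cont continuous_on_powr')
         (auto intro: less_imp_le)
    finally have X: "(\<integral>\<^sup>+x. ennreal (\<Phi> x powr \<theta>) * (indicator \<Omega> x * ennreal ((w x)\<^sup>2)) \<partial>lborel) = ennreal X" .
    have Y: "(\<integral>\<^sup>+x. indicator \<Omega> x * ennreal ((norm (G x))\<^sup>2) \<partial>lborel) = ennreal Y"
      unfolding Y_def by (intro nn_integral_eq_set_integral int continuous_intros cont) auto
    have Z: "(\<integral>\<^sup>+x. indicator \<Omega> x * ennreal ((w x)\<^sup>2) \<partial>lborel) = ennreal Z"
      unfolding Z_def by (intro nn_integral_eq_set_integral int continuous_intros cont) auto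
    have "ennreal b * ennreal X
        \<le> ennreal (8 * (real N)\<^sup>2 * \<eta>\<^sup>2 * K) * ennreal Y
          + ennreal (2 * K * (\<eta> ^ N) powr (- real DIM('a) * \<theta>)) * ennreal Z"
      unfolding b_def K_def X[symmetric] Y[symmetric] Z[symmetric]
      by (rule nn_integral_potential_le[OF \<open>open \<Omega>\<close> d cone continuous_on_subset[OF cont(3) closure_subset] G
            \<Phi>_measurable \<Phi>_nonneg \<Phi>_le \<open>m > 0\<close> \<theta>(1,2) \<eta> \<open>N \<ge> 1\<close> N])
    then have "b * X \<le> (8 * (real N)\<^sup>2 * \<eta>\<^sup>2 * K) * Y + (2 * K * (\<eta> ^ N) powr (- real DIM('a) * \<theta>)) * Z"
      using \<open>b > 0\<close> \<open>K > 0\<close> nonneg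
      by (simp add: ennreal_mult[symmetric] ennreal_plus[symmetric] del: ennreal_plus)
    also have "\<dots> \<le> (\<epsilon> * b) * Y + (C * b) * Z"
      using \<eta>_sq nonneg \<open>b > 0\<close> by (intro add_mono mult_right_mono) (auto simp: C_def)
    also have "\<dots> = b * (\<epsilon> * Y + C * Z)"
      by (simp add: algebra_simps)
    finally show ?thesis
      using \<open>b > 0\<close> by (simp add: X_def Y_def Z_def)
  qed
  then show ?thesis
    using \<open>C > 0\<close> by blast
qed

subsection \<open>Absorption\<close>

text \<open>Testing the common derivative on \<open>D - E\<close> gives a vanishing norm. This
  justifies the \<open>THE\<close> in \<open>gradient\<close>.\<close>

lemma GDERIV_unique:
  assumes "GDERIV f x :> D" and "GDERIV f x :> E"
  shows "D = E"
proof -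
  have "(\<lambda>h. h \<bullet> D) = (\<lambda>h. h \<bullet> E)"
    using assms has_derivative_unique unfolding gderiv_def by blast
  then have "(D - E) \<bullet> D = (D - E) \<bullet> E"
    by meson
  then have "(D - E) \<bullet> (D - E) = 0"
    by (simp add: inner_diff_right)
  then show ?thesis
    by simp
qed

lemma gradient_eq:
  assumes "GDERIV f x :> D"
  shows "gradient f x = D"
  unfolding gradient_def using assms GDERIV_unique by blast

lemma GDERIV_powr:
  assumes "GDERIV f x :> D" and "f x > 0"
  shows "GDERIV (\<lambda>x. f x powr a) x :> (a * f x powr (a - 1)) *\<^sub>R D"
  by (rule GDERIV_DERIV_compose[OF assms(1)]) (use assms(2) in \<open>auto intro!: derivative_eq_intros\<close>)

text \<open>Weighted Young with weights \<open>s = (k + 2) / \<beta>\<close> and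
  \<open>1 - s\<close>, both then bounded by 1. The exponent \<open>P\<close> is determined by
  \<open>P * (1 - s) = 2\<close>, and the power \<open>P - 1\<close> of \<open>g\<close> by the
  requirement that \<open>g\<close> end up with exponent -1.\<close>

lemma powr_Young_quotient:
  fixes f g a k \<beta> :: real
  assumes "f > 0" and "g > 0" and "a \<ge> 0" and k: "k > -2" "k + 2 < \<beta>"
  defines "P \<equiv> 2 * \<beta> / (\<beta> - k - 2)"
  shows "f powr (k + 2) * a\<^sup>2 / g \<le> f powr \<beta> * g + a powr P / g powr (P - 1)"
proof (cases "a = 0")
  case False
  then have "a > 0"
    using \<open>a \<ge> 0\<close> by simp
  define s where "s = (k + 2) / \<beta>"
  have s: "0 \<le> s" "s \<le> 1"
    using k by (auto simp: s_def)
  have "1 - s = (\<beta> - k - 2) / \<beta>"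
    using k by (simp add: s_def field_simps)
  then have exps: "\<beta> * s = k + 2" "P * (1 - s) = 2"
    using k by (auto simp: s_def P_def)
  then have exp_g: "s - (P - 1) * (1 - s) = -1"
    by (simp add: algebra_simps)
  let ?x = "f powr \<beta> * g" and ?y = "a powr P / g powr (P - 1)"
  have pos: "?x > 0" "?y > 0"
    using assms \<open>a > 0\<close> by auto
  have "f powr (k + 2) * a\<^sup>2 / g = f powr (\<beta> * s) * a powr (P * (1 - s)) * g powr (s - (P - 1) * (1 - s))"
    unfolding exps exp_g using assms \<open>a > 0\<close> by (simp add: powr_minus divide_inverse power2_eq_square)
  also have "\<dots> = ?x powr s * ?y powr (1 - s)"
    unfolding powr_diff[of g s] using \<open>f > 0\<close> \<open>g > 0\<close> \<open>a > 0\<close>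
    by (simp add: powr_mult powr_divide powr_powr)
  also have "\<dots> \<le> s * ?x + (1 - s) * ?y"
    using s pos by (intro Youngs_inequality_0) auto
  also have "\<dots> \<le> 1 * ?x + 1 * ?y"
    using s pos by (intro add_mono mult_right_mono) auto
  finally show ?thesis
    by simp
qed (use assms in simp)

text \<open>Split at \<open>f powr (\<beta> - k - 2) = 1 / \<epsilon>\<close>: above this threshold
  the term in \<open>f powr \<beta>\<close> dominates, below it \<open>f powr (k + 1)\<close> is
  bounded because \<open>k + 1 > 0\<close>.\<close>

lemma powr_interpolate:
  fixes f k \<beta> \<epsilon> :: real
  assumes "f > 0" and "\<epsilon> > 0" and k: "k > -1" "k + 2 < \<beta>"
  shows "f powr (k + 2) \<le> \<epsilon> * f powr \<beta> + (1 / \<epsilon>) powr ((k + 1) / (\<beta> - k - 2)) * f"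
proof (cases "1 / \<epsilon> \<le> f powr (\<beta> - k - 2)")
  case True
  then have "1 \<le> \<epsilon> * f powr (\<beta> - k - 2)"
    using \<open>\<epsilon> > 0\<close> by (simp add: field_simps)
  then have "f powr (k + 2) * 1 \<le> f powr (k + 2) * (\<epsilon> * f powr (\<beta> - k - 2))"
    by (intro mult_left_mono) auto
  also have "\<dots> = \<epsilon> * f powr \<beta>"
    using powr_add[of f "k + 2" "\<beta> - k - 2"] by (simp add: mult.left_commute)
  finally show ?thesis
    using \<open>f > 0\<close> by (simp add: add_increasing2)
next
  case False
  then have "(f powr (\<beta> - k - 2)) powr ((k + 1) / (\<beta> - k - 2)) \<le> (1 / \<epsilon>) powr ((k + 1) / (\<beta> - k - 2))"
    using k by (intro powr_mono2) auto
  then have "f powr (k + 1) \<le> (1 / \<epsilon>) powr ((k + 1) / (\<beta> - k - 2))"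
    using k by (simp add: powr_powr)
  then have "f powr (k + 1) * f \<le> (1 / \<epsilon>) powr ((k + 1) / (\<beta> - k - 2)) * f"
    using \<open>f > 0\<close> by (intro mult_right_mono) auto
  moreover have "f powr (k + 1) * f = f powr (k + 2)"
    using \<open>f > 0\<close> powr_mult_base[of f "k + 1"] by (simp add: mult.commute add.commute)
  ultimately show ?thesis
    using \<open>\<epsilon> > 0\<close> by (simp add: add_increasing)
qed

text \<open>For \<open>u\<close> and \<open>v\<close> the gradients of \<open>f\<close> and
  \<open>g\<close>, the vector is the gradient of \<open>f powr p * g powr (1/2)\<close> in the form
  given by the product rule. The squared norm of a sum is at most twice the sum of the squared
  norms, which yields the coefficients \<open>2 * p\<^sup>2\<close> and
  \<open>2 * (1/4)\<close>.\<close>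

lemma norm_gradient_weight_le:
  fixes u v :: "'a::real_inner" and f g k :: real
  assumes "f > 0" and "g > 0"
  defines "p \<equiv> (k + 2) / 2"
  shows "(norm (f powr p *\<^sub>R ((1/2 * g powr (1/2 - 1)) *\<^sub>R v) + g powr (1/2) *\<^sub>R ((p * f powr (p - 1)) *\<^sub>R u)))\<^sup>2
    \<le> (k + 2)\<^sup>2 / 2 * (f powr k * g * (norm u)\<^sup>2) + 1/2 * (f powr (k + 2) * (norm v)\<^sup>2 / g)"
proof -
  define y where "y = f powr p *\<^sub>R ((1/2 * g powr (1/2 - 1)) *\<^sub>R v)"
  define z where "z = g powr (1/2) *\<^sub>R ((p * f powr (p - 1)) *\<^sub>R u)"
  have sq: "(a powr r)\<^sup>2 = a powr (2 * r)" if "a > 0" for a r :: real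
    using that by (simp add: powr_powr mult.commute flip: powr_numeral)
  have exps: "2 * p = k + 2" "2 * (p - 1) = k" "2 * (1/2 - 1) = (-1::real)" "2 * (1/2) = (1::real)"
    by (auto simp: p_def field_simps)
  have "norm (y + z) \<le> norm y + norm z"
    by (rule norm_triangle_ineq)
  then have "(norm (y + z))\<^sup>2 \<le> (norm y + norm z)\<^sup>2"
    by (intro power_mono) auto
  also have "\<dots> \<le> 2 * (norm z)\<^sup>2 + 2 * (norm y)\<^sup>2"
    using zero_le_power2[of "norm y - norm z"] by (simp add: power2_eq_square algebra_simps)
  finally have "(norm (y + z))\<^sup>2 \<le> 2 * (norm z)\<^sup>2 + 2 * (norm y)\<^sup>2" .
  moreover have "(norm y)\<^sup>2 = f powr (k + 2) * (1/4 * inverse g * (norm v)\<^sup>2)"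
  proof -
    have "(norm y)\<^sup>2 = (f powr p)\<^sup>2 * ((1/2)\<^sup>2 * (g powr (1/2 - 1))\<^sup>2 * (norm v)\<^sup>2)"
      by (simp add: y_def power_mult_distrib power_divide)
    then show ?thesis
      unfolding sq[OF \<open>f > 0\<close>] sq[OF \<open>g > 0\<close>] exps
      using \<open>g > 0\<close> by (simp add: powr_minus power2_eq_square)
  qed
  moreover have "(norm z)\<^sup>2 = g * ((k + 2)\<^sup>2 / 4 * f powr k * (norm u)\<^sup>2)"
  proof -
    have "(norm z)\<^sup>2 = (g powr (1/2))\<^sup>2 * (p\<^sup>2 * (f powr (p - 1))\<^sup>2 * (norm u)\<^sup>2)"
      by (simp add: z_def power_mult_distrib)
    then show ?thesis
      unfolding sq[OF \<open>f > 0\<close>] sq[OF \<open>g > 0\<close>] exps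
      using \<open>g > 0\<close> by (simp add: p_def power_divide)
  qed
  ultimately have "(norm (y + z))\<^sup>2
      \<le> 2 * (g * ((k + 2)\<^sup>2 / 4 * f powr k * (norm u)\<^sup>2)) + 2 * (f powr (k + 2) * (1/4 * inverse g * (norm v)\<^sup>2))"
    by (simp only:)
  also have "\<dots> = (k + 2)\<^sup>2 / 2 * (f powr k * g * (norm u)\<^sup>2) + 1/2 * (f powr (k + 2) * (norm v)\<^sup>2 / g)"
  proof -
    have "2 * (g * (c / 4 * a * U)) + 2 * (b * (1/4 * inverse g * V)) = c / 2 * (a * g * U) + 1/2 * (b * V / g)"
      for a b c U V :: real
      using \<open>g > 0\<close> by (simp add: field_simps)
    then show ?thesis .
  qed
  finally show ?thesis
    unfolding y_def z_def .
qed

section \<open>Choice of constants and proof of the integral inequality\<close>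

theorem lemma3p4:
  fixes \<Omega> :: "(real^3) set" and k \<beta> :: real
  assumes "open \<Omega>" and "connected \<Omega>" and "\<Omega> \<noteq> {}" and "bounded \<Omega>"
    and "smooth_boundary \<Omega>"
    and "k > -1" and "\<beta> \<in> {k + 2 <..< k + 8/3}"
  shows "\<exists>C1>0. \<forall>m>0. \<exists>C2>0. \<forall>\<phi> \<psi> :: real^3 \<Rightarrow> real.
    C1_closure \<Omega> \<phi> \<longrightarrow> C1_closure \<Omega> \<psi> \<longrightarrow>
    (\<forall>x\<in>closure \<Omega>. \<phi> x > 0) \<longrightarrow> (\<forall>x\<in>closure \<Omega>. \<psi> x > 0) \<longrightarrow>
    (LINT x:\<Omega>|lborel. \<phi> x) \<le> m \<longrightarrow>
    (LINT x:\<Omega>|lborel. \<phi> x powr \<beta> * \<psi> x)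
      \<le> 2 * (LINT x:\<Omega>|lborel. \<phi> x powr k * \<psi> x * (norm (gradient \<phi> x))\<^sup>2)
        + C1 * (LINT x:\<Omega>|lborel. norm (gradient \<psi> x) powr (2 * \<beta> / (\<beta> - k - 2))
                                  / \<psi> x powr (2 * \<beta> / (\<beta> - k - 2) - 1))
        + C2 * (LINT x:\<Omega>|lborel. \<phi> x * \<psi> x)"
proof (rule exI[of _ "1/2"], intro conjI allI impI)
  \<comment> \<open>The value 1/2 is chosen before \<open>m\<close>: the gradient term of
    \<open>\<psi>\<close> enters with coefficient at most 1/4, doubled when half of the left side is
    absorbed.\<close>
  fix m :: real assume "m > 0"
  define \<theta> where "\<theta> = \<beta> - k - 2"
  \<comment> \<open>The bound 1/2 leaves at most a quarter of the left side to absorb here; the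
    bound \<open>2 / (k + 2)\<^sup>2\<close> reduces the coefficient of the \<open>\<phi>\<close>
    gradient term to at most 1.\<close>
  define \<epsilon> where "\<epsilon> = min (1/2) (2 / (k + 2)\<^sup>2)"
  define P where "P = 2 * \<beta> / (\<beta> - k - 2)"
  have k: "k > -1" "k + 2 < \<beta>" "\<beta> < k + 8/3"
    using assms by auto
  then have \<theta>: "0 < \<theta>" "\<theta> < 1" "DIM(real^3) * \<theta> < 2"
    by (auto simp: \<theta>_def)
  have "P > 0"
    using k by (simp add: P_def)
  have "(k + 2)\<^sup>2 > 0"
    using k by simp
  then have \<epsilon>: "0 < \<epsilon>" "\<epsilon> \<le> 1/2" "\<epsilon> * (k + 2)\<^sup>2 \<le> 2"
    by (auto simp: \<epsilon>_def min_def field_simps)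
  obtain d where d: "0 < d" "d \<le> 1" and cone: "\<And>x. x \<in> \<Omega> \<Longrightarrow> cone_at d \<Omega> x"
    using uniform_cone[OF \<open>open \<Omega>\<close> \<open>bounded \<Omega>\<close> \<open>smooth_boundary \<Omega>\<close>] by blast
  obtain C where "C > 0" and C: "\<And>(\<phi> :: real^3 \<Rightarrow> real) w G.
    continuous_on (closure \<Omega>) \<phi> \<Longrightarrow> (\<forall>x\<in>closure \<Omega>. \<phi> x > 0) \<Longrightarrow> (LINT x:\<Omega>|lborel. \<phi> x) \<le> m \<Longrightarrow>
    continuous_on (closure \<Omega>) w \<Longrightarrow> continuous_on (closure \<Omega>) G \<Longrightarrow> (\<forall>y\<in>\<Omega>. GDERIV w y :> G y) \<Longrightarrow>
    (LINT x:\<Omega>|lborel. \<phi> x powr \<theta> * (w x)\<^sup>2)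
      \<le> \<epsilon> * (LINT x:\<Omega>|lborel. (norm (G x))\<^sup>2) + C * (LINT x:\<Omega>|lborel. (w x)\<^sup>2)"
    using integral_potential_le[OF \<open>open \<Omega>\<close> \<open>bounded \<Omega>\<close> d cone \<theta> \<open>m > 0\<close> \<epsilon>(1)] by blast
  \<comment> \<open>Now \<open>C * \<delta> = 1/4\<close>, a second quarter to be absorbed. The mass
    bound \<open>m\<close> enters these constants only through \<open>C\<close>.\<close>
  define \<delta> where "\<delta> = 1 / (4 * C)"
  have "\<delta> > 0"
    using \<open>C > 0\<close> by (simp add: \<delta>_def)
  define C' where "C' = (1 / \<delta>) powr ((k + 1) / (\<beta> - k - 2))"
  have "C' > 0"
    using \<open>\<delta> > 0\<close> by (simp add: C'_def)
  show "\<exists>C2>0. \<forall>\<phi> \<psi> :: real^3 \<Rightarrow> real.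
    C1_closure \<Omega> \<phi> \<longrightarrow> C1_closure \<Omega> \<psi> \<longrightarrow>
    (\<forall>x\<in>closure \<Omega>. \<phi> x > 0) \<longrightarrow> (\<forall>x\<in>closure \<Omega>. \<psi> x > 0) \<longrightarrow>
    (LINT x:\<Omega>|lborel. \<phi> x) \<le> m \<longrightarrow>
    (LINT x:\<Omega>|lborel. \<phi> x powr \<beta> * \<psi> x)
      \<le> 2 * (LINT x:\<Omega>|lborel. \<phi> x powr k * \<psi> x * (norm (gradient \<phi> x))\<^sup>2)
        + 1/2 * (LINT x:\<Omega>|lborel. norm (gradient \<psi> x) powr (2 * \<beta> / (\<beta> - k - 2))
                                  / \<psi> x powr (2 * \<beta> / (\<beta> - k - 2) - 1))
        + C2 * (LINT x:\<Omega>|lborel. \<phi> x * \<psi> x)"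
    unfolding P_def[symmetric]
  proof (intro exI[of _ "2 * C * C'"] conjI allI impI)
    fix \<phi> \<psi> :: "real^3 \<Rightarrow> real"
    assume "C1_closure \<Omega> \<phi>" and "C1_closure \<Omega> \<psi>"
      and \<phi>: "\<forall>x\<in>closure \<Omega>. \<phi> x > 0" and \<psi>: "\<forall>x\<in>closure \<Omega>. \<psi> x > 0"
      and le_m: "(LINT x:\<Omega>|lborel. \<phi> x) \<le> m"
    then obtain F G where cont: "continuous_on (closure \<Omega>) \<phi>" "continuous_on (closure \<Omega>) \<psi>"
        "continuous_on (closure \<Omega>) F" "continuous_on (closure \<Omega>) G"
      and F: "\<And>x. x \<in> \<Omega> \<Longrightarrow> GDERIV \<phi> x :> F x" and G: "\<And>x. x \<in> \<Omega> \<Longrightarrow> GDERIV \<psi> x :> G x"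
      unfolding C1_closure_def by blast
    have pos: "\<phi> x > 0" "\<psi> x > 0" if "x \<in> \<Omega>" for x
      using \<phi> \<psi> that closure_subset by blast+
    have ne: "\<forall>x\<in>closure \<Omega>. \<phi> x \<noteq> 0" "\<forall>x\<in>closure \<Omega>. \<psi> x \<noteq> 0"
      using \<phi> \<psi> by force+
    note int = set_integrable_continuous_on_closure[OF \<open>open \<Omega>\<close> \<open>bounded \<Omega>\<close>]
    define p where "p = (k + 2) / 2"
    define w where "w x = \<phi> x powr p * \<psi> x powr (1/2)" for x
    define H where "H x = \<phi> x powr p *\<^sub>R ((1/2 * \<psi> x powr (1/2 - 1)) *\<^sub>R G x)
      + \<psi> x powr (1/2) *\<^sub>R ((p * \<phi> x powr (p - 1)) *\<^sub>R F x)" for x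
    have w_sq: "(w x)\<^sup>2 = \<phi> x powr (k + 2) * \<psi> x" if "x \<in> \<Omega>" for x
    proof -
      have "p * 2 = k + 2"
        by (simp add: p_def)
      then show ?thesis
        using pos[OF that] by (simp add: w_def power_mult_distrib powr_powr flip: powr_numeral)
    qed
    have cont_w: "continuous_on (closure \<Omega>) w"
      unfolding w_def using ne by (intro continuous_intros cont) auto
    have cont_H: "continuous_on (closure \<Omega>) H"
      unfolding H_def using ne by (intro continuous_intros cont) auto
    have w: "\<forall>x\<in>\<Omega>. GDERIV w x :> H x"
      unfolding w_def[abs_def] H_def using pos by (intro ballI GDERIV_mult GDERIV_powr F G) auto
    \<comment> \<open>The integrands are written with the continuous extensions \<open>F\<close> and
      \<open>G\<close>, which makes them continuous on the closure and hence integrable;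
      \<open>gradient\<close> agrees with them inside \<open>\<Omega>\<close>.\<close>
    define x where "x y = \<phi> y powr \<beta> * \<psi> y" for y
    define y where "y z = \<phi> z powr k * \<psi> z * (norm (F z))\<^sup>2" for z
    define z where "z y = norm (G y) powr P / \<psi> y powr (P - 1)" for y
    have int_x: "set_integrable lborel \<Omega> x"
      unfolding x_def[abs_def] using ne by (intro int continuous_intros cont) auto
    have int_y: "set_integrable lborel \<Omega> y"
      unfolding y_def[abs_def] using ne by (intro int continuous_intros cont) auto
    \<comment> \<open>The norm of \<open>G\<close> may vanish, so continuity of its power relies on
      \<open>P > 0\<close>.\<close>
    have int_z: "set_integrable lborel \<Omega> z"
      unfolding z_def[abs_def] using ne \<open>P > 0\<close>
      by (intro int continuous_on_divide continuous_on_powr'[of _ "\<lambda>y. norm (G y)"] continuous_intros cont) auto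
    have int_\<phi>\<psi>: "set_integrable lborel \<Omega> (\<lambda>x. \<phi> x * \<psi> x)"
      by (intro int continuous_intros cont)
    have "(LINT x:\<Omega>|lborel. (norm (H x))\<^sup>2) \<le> (LINT t:\<Omega>|lborel. (k + 2)\<^sup>2 / 2 * y t + 1/2 * (x t + z t))"
    proof (rule set_integral_mono)
      show "set_integrable lborel \<Omega> (\<lambda>x. (norm (H x))\<^sup>2)"
        by (intro int continuous_intros cont_H)
      show "set_integrable lborel \<Omega> (\<lambda>t. (k + 2)\<^sup>2 / 2 * y t + 1/2 * (x t + z t))"
        by (intro set_integral_add set_integrable_mult_right int_x int_y int_z)
      fix t assume t: "t \<in> \<Omega>"
      have "(norm (H t))\<^sup>2 \<le> (k + 2)\<^sup>2 / 2 * y t + 1/2 * (\<phi> t powr (k + 2) * (norm (G t))\<^sup>2 / \<psi> t)"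
        unfolding H_def y_def p_def by (rule norm_gradient_weight_le[OF pos[OF t]])
      also have "\<phi> t powr (k + 2) * (norm (G t))\<^sup>2 / \<psi> t \<le> x t + z t"
        unfolding x_def z_def P_def using pos[OF t] k by (intro powr_Young_quotient) auto
      finally show "(norm (H t))\<^sup>2 \<le> (k + 2)\<^sup>2 / 2 * y t + 1/2 * (x t + z t)"
        by simp
    qed
    also have "\<dots> = (k + 2)\<^sup>2 / 2 * (LINT t:\<Omega>|lborel. y t) + 1/2 * ((LINT t:\<Omega>|lborel. x t) + (LINT t:\<Omega>|lborel. z t))"
      using int_x int_y int_z by (simp add: set_integral_add set_integrable_mult_right)
    finally have H_le: "(LINT x:\<Omega>|lborel. (norm (H x))\<^sup>2)
      \<le> (k + 2)\<^sup>2 / 2 * (LINT t:\<Omega>|lborel. y t) + 1/2 * ((LINT t:\<Omega>|lborel. x t) + (LINT t:\<Omega>|lborel. z t))" .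
    have "(LINT x:\<Omega>|lborel. (w x)\<^sup>2) \<le> (LINT t:\<Omega>|lborel. \<delta> * x t + C' * (\<phi> t * \<psi> t))"
    proof (rule set_integral_mono)
      show "set_integrable lborel \<Omega> (\<lambda>x. (w x)\<^sup>2)"
        by (intro int continuous_intros cont_w)
      show "set_integrable lborel \<Omega> (\<lambda>t. \<delta> * x t + C' * (\<phi> t * \<psi> t))"
        by (intro set_integral_add set_integrable_mult_right int_x int_\<phi>\<psi>)
      fix t assume t: "t \<in> \<Omega>"
      have "\<phi> t powr (k + 2) * \<psi> t \<le> (\<delta> * \<phi> t powr \<beta> + C' * \<phi> t) * \<psi> t"
        unfolding C'_def using pos[OF t] \<open>\<delta> > 0\<close> k by (intro mult_right_mono powr_interpolate) auto
      then show "(w t)\<^sup>2 \<le> \<delta> * x t + C' * (\<phi> t * \<psi> t)"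
        by (simp add: w_sq[OF t] x_def algebra_simps)
    qed
    also have "\<dots> = \<delta> * (LINT t:\<Omega>|lborel. x t) + C' * (LINT t:\<Omega>|lborel. \<phi> t * \<psi> t)"
      using int_x int_\<phi>\<psi> by (simp add: set_integral_add set_integrable_mult_right)
    finally have w_le: "(LINT x:\<Omega>|lborel. (w x)\<^sup>2)
      \<le> \<delta> * (LINT t:\<Omega>|lborel. x t) + C' * (LINT t:\<Omega>|lborel. \<phi> t * \<psi> t)" .
    define X where "X = (LINT t:\<Omega>|lborel. x t)"
    define Y where "Y = (LINT t:\<Omega>|lborel. y t)"
    define Z where "Z = (LINT t:\<Omega>|lborel. z t)"
    define J where "J = (LINT t:\<Omega>|lborel. \<phi> t * \<psi> t)"
    have nonneg: "X \<ge> 0" "Y \<ge> 0" "Z \<ge> 0"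
      unfolding X_def Y_def Z_def x_def y_def z_def set_lebesgue_integral_def
      using pos by (auto intro!: Bochner_Integration.integral_nonneg simp: indicator_def less_imp_le)
    \<comment> \<open>This is the splitting \<open>\<beta> = \<theta> + (k + 2)\<close> of the
      exponent.\<close>
    have "X = (LINT x:\<Omega>|lborel. \<phi> x powr \<theta> * (w x)\<^sup>2)"
      unfolding X_def x_def using \<open>open \<Omega>\<close>
      by (intro set_lebesgue_integral_cong) (auto simp: w_sq \<theta>_def powr_add[symmetric] simp flip: mult.assoc)
    also have "\<dots> \<le> \<epsilon> * (LINT x:\<Omega>|lborel. (norm (H x))\<^sup>2) + C * (LINT x:\<Omega>|lborel. (w x)\<^sup>2)"
      by (rule C[OF cont(1) \<phi> le_m cont_w cont_H w])
    also have "\<dots> \<le> \<epsilon> * ((k + 2)\<^sup>2 / 2 * Y + 1/2 * (X + Z)) + C * (\<delta> * X + C' * J)"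
      unfolding X_def Y_def Z_def J_def using \<epsilon> \<open>C > 0\<close> H_le w_le by (intro add_mono mult_left_mono) auto
    also have "\<dots> = (\<epsilon> * (k + 2)\<^sup>2) / 2 * Y + \<epsilon> / 2 * (X + Z) + 1/4 * X + C * C' * J"
      using \<open>C > 0\<close> by (simp add: \<delta>_def field_simps)
    also have "\<dots> \<le> 2 / 2 * Y + (1/2) / 2 * (X + Z) + 1/4 * X + C * C' * J"
      using \<epsilon> nonneg by (intro add_mono mult_right_mono divide_right_mono order_refl) auto
    \<comment> \<open>On the right \<open>X\<close> has total coefficient 1/4 + 1/4; subtracting it
      and doubling gives the claim.\<close>
    finally have "X \<le> 2 * Y + 1/2 * Z + 2 * (C * C' * J)"
      by argo
    then have "X \<le> 2 * Y + 1/2 * Z + 2 * C * C' * J"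
      by (simp only: mult.assoc)
    moreover have "Y = (LINT x:\<Omega>|lborel. \<phi> x powr k * \<psi> x * (norm (gradient \<phi> x))\<^sup>2)"
      unfolding Y_def y_def using \<open>open \<Omega>\<close> by (intro set_lebesgue_integral_cong) (auto simp: gradient_eq[OF F])
    moreover have "Z = (LINT x:\<Omega>|lborel. norm (gradient \<psi> x) powr P / \<psi> x powr (P - 1))"
      unfolding Z_def z_def using \<open>open \<Omega>\<close> by (intro set_lebesgue_integral_cong) (auto simp: gradient_eq[OF G])
    ultimately show "(LINT x:\<Omega>|lborel. \<phi> x powr \<beta> * \<psi> x)
      \<le> 2 * (LINT x:\<Omega>|lborel. \<phi> x powr k * \<psi> x * (norm (gradient \<phi> x))\<^sup>2)
        + 1/2 * (LINT x:\<Omega>|lborel. norm (gradient \<psi> x) powr P / \<psi> x powr (P - 1))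
        + 2 * C * C' * (LINT x:\<Omega>|lborel. \<phi> x * \<psi> x)"
      by (simp add: X_def x_def J_def)
  qed (use \<open>C > 0\<close> \<open>C' > 0\<close> in simp)
qed simp

end
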